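(* Let $\Theta$ be a finite simplicial $2$-connected $3$-valent planar graph, with a given embedding $\Theta\subset S^2$. Then the following are equivalent: (a) $\Theta$ has a Hamilton cycle; (b) the vertex-face-incidence graph $\mathcal{VF}(\Theta)$ has a strongly legal state; (c) $\mathcal{VF}(\Theta)$ has a legal system.
   Context: A cycle in $\Theta$ is a subgraph homeomorphic to a circle; it is a Hamilton (hamiltonian) cycle if every vertex of $\Theta$ lies in it. $\Theta$ is $k$-connected if there is no set $U$ of at most $k-1$ vertices such that the subgraph induced by the remaining vertices is disconnected. Given an embedding $\Theta\subset S^2$, the set $F$ of faces is the set of components of $S^2-\Theta$. The vertex-face-incidence graph $\mathcal{VF}(\Theta)$ is the bipartite graph with vertex set $V(\Theta)\sqcup F$ in which $v\in V(\Theta)$ is joined to $f\in F$ by an edge if and only if $v\in\partial f$. Let $\Gamma=\Gamma(V,E)$ be a simplicial graph. A state is a subset $S\subset V$; it is legal if the subgraphs of $\Gamma$ induced by $S$ and by $V-S$ are both nonempty and connected. A state $S$ is strongly legal if it is legal and moreover each vertex of $S$ is adjacent to a vertex of $V-S$ and each vertex of $V-S$ is adjacent to a vertex of $S$. A move at $v\in V$ is a subset $m_v\subset V$ with $v\in m_v$ and $u\notin m_v$ whenever $\{u,v\}\in E$. A system of moves is a choice of a move $m_v$ for each $v\in V$ (the $m_v$ need not be distinct). Identify $2^V$ with the group $\mathbb{Z}_2^V$ (multiplication is symmetric difference), and let $M\le\mathbb{Z}_2^V$ be the subgroup generated by the moves; $M$ acts on the set of states by symmetric difference. The system is legal if there is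 an $M$-orbit all of whose elements are legal states; $\Gamma$ has a legal system if some system of moves for $\Gamma$ is legal. *)

theory Defs
  imports "HOL-Analysis.Analysis" "HOL-Algebra.Generated_Groups" "HOL-Algebra.Group_Action"
begin

section \<open>Graphs\<close>

record 'v sgraph =
  verts :: "'v set"
  edges :: "'v set set"

definition simplicial_graph :: "'v sgraph \<Rightarrow> bool" where
  "simplicial_graph \<Gamma> \<longleftrightarrow> (\<forall>e\<in>edges \<Gamma>. e \<subseteq> verts \<Gamma> \<and> card e = 2)"

definition subgraph :: "'v sgraph \<Rightarrow> 'v sgraph \<Rightarrow> bool" where
  "subgraph \<Delta> \<Gamma> \<longleftrightarrow>
     verts \<Delta> \<subseteq> verts \<Gamma> \<and> edges \<Delta> \<subseteq> edges \<Gamma> \<and> (\<forall>e\<in>edges \<Delta>. e \<subseteq> verts \<Delta>)"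

definition valent :: "nat \<Rightarrow> 'v sgraph \<Rightarrow> bool" where
  "valent d \<Gamma> \<longleftrightarrow> (\<forall>v\<in>verts \<Gamma>. card {e \<in> edges \<Gamma>. v \<in> e} = d)"

text \<open>Connectedness of the subgraph induced by \<open>W\<close>.  It holds vacuously for \<open>W = {}\<close>;
  nonemptiness is demanded separately wherever it matters.\<close>

definition induces_connected :: "'v sgraph \<Rightarrow> 'v set \<Rightarrow> bool" where
  "induces_connected \<Gamma> W \<longleftrightarrow>
     (\<forall>u\<in>W. \<forall>v\<in>W. (\<lambda>x y. x \<in> W \<and> y \<in> W \<and> {x, y} \<in> edges \<Gamma>)\<^sup>*\<^sup>* u v)"

definition k_connected :: "nat \<Rightarrow> 'v sgraph \<Rightarrow> bool" where
  "k_connected k \<Gamma> \<longleftrightarrow>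
     \<not> (\<exists>U. U \<subseteq> verts \<Gamma> \<and> finite U \<and> card U \<le> k - 1 \<and> \<not> induces_connected \<Gamma> (verts \<Gamma> - U))"

section \<open>States, moves and legal systems\<close>

definition legal_state :: "'v sgraph \<Rightarrow> 'v set \<Rightarrow> bool" where
  "legal_state \<Gamma> S \<longleftrightarrow>
     S \<subseteq> verts \<Gamma> \<and>
     S \<noteq> {} \<and> induces_connected \<Gamma> S \<and>
     verts \<Gamma> - S \<noteq> {} \<and> induces_connected \<Gamma> (verts \<Gamma> - S)"

definition strongly_legal_state :: "'v sgraph \<Rightarrow> 'v set \<Rightarrow> bool" where
  "strongly_legal_state \<Gamma> S \<longleftrightarrow>
     legal_state \<Gamma> S \<and>
     (\<forall>u\<in>S. \<exists>v\<in>verts \<Gamma> - S. {u, v} \<in> edges \<Gamma>) \<and>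
     (\<forall>v\<in>verts \<Gamma> - S. \<exists>u\<in>S. {u, v} \<in> edges \<Gamma>)"

definition move_at :: "'v sgraph \<Rightarrow> 'v \<Rightarrow> 'v set \<Rightarrow> bool" where
  "move_at \<Gamma> v m \<longleftrightarrow>
     m \<subseteq> verts \<Gamma> \<and> v \<in> m \<and> (\<forall>u. {u, v} \<in> edges \<Gamma> \<longrightarrow> u \<notin> m)"

definition move_system :: "'v sgraph \<Rightarrow> ('v \<Rightarrow> 'v set) \<Rightarrow> bool" where
  "move_system \<Gamma> m \<longleftrightarrow> (\<forall>v\<in>verts \<Gamma>. move_at \<Gamma> v (m v))"

text \<open>The group \<open>\<int>\<^sub>2\<^sup>V\<close>, realised on the power set of \<open>V\<close>.\<close>

definition state_group :: "'v sgraph \<Rightarrow> 'v set monoid" where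
  "state_group \<Gamma> = \<lparr>carrier = Pow (verts \<Gamma>), mult = sym_diff, one = {}\<rparr>"

lemma comm_group_state_group: "comm_group (state_group \<Gamma>)"
  by (rule comm_groupI) (auto simp: state_group_def)

definition moves_group :: "'v sgraph \<Rightarrow> ('v \<Rightarrow> 'v set) \<Rightarrow> 'v set monoid" where
  "moves_group \<Gamma> m =
     (state_group \<Gamma>)\<lparr>carrier := generate (state_group \<Gamma>) (m ` verts \<Gamma>)\<rparr>"

definition legal_system :: "'v sgraph \<Rightarrow> ('v \<Rightarrow> 'v set) \<Rightarrow> bool" where
  "legal_system \<Gamma> m \<longleftrightarrow>
     move_system \<Gamma> m \<and>
     (\<exists>S. S \<subseteq> verts \<Gamma> \<and> (\<forall>T\<in>orbit (moves_group \<Gamma> m) sym_diff S. legal_state \<Gamma> T))"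

definition has_legal_system :: "'v sgraph \<Rightarrow> bool" where
  "has_legal_system \<Gamma> \<longleftrightarrow> (\<exists>m. legal_system \<Gamma> m)"

section \<open>Graphs embedded in the 2-sphere\<close>

abbreviation S2 :: "(real ^ 3) set" where
  "S2 \<equiv> sphere 0 1"

text \<open>A topological embedding: \<open>p\<close> places the vertices, and \<open>g e\<close> is an arc representing the
  edge \<open>e\<close>; no tameness of the arcs is required.\<close>

definition sphere_embedding ::
    "'v sgraph \<Rightarrow> ('v \<Rightarrow> real ^ 3) \<Rightarrow> ('v set \<Rightarrow> real \<Rightarrow> real ^ 3) \<Rightarrow> bool" where
  "sphere_embedding \<Theta> p g \<longleftrightarrow>
     inj_on p (verts \<Theta>) \<and> p ` verts \<Theta> \<subseteq> S2 \<and>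
     (\<forall>e\<in>edges \<Theta>. arc (g e) \<and> path_image (g e) \<subseteq> S2 \<and>
        {pathstart (g e), pathfinish (g e)} = p ` e \<and>
        path_image (g e) \<inter> p ` verts \<Theta> = p ` e) \<and>
     (\<forall>e\<in>edges \<Theta>. \<forall>e'\<in>edges \<Theta>. e \<noteq> e' \<longrightarrow>
        path_image (g e) \<inter> path_image (g e') = p ` (e \<inter> e'))"

definition realization ::
    "('v \<Rightarrow> real ^ 3) \<Rightarrow> ('v set \<Rightarrow> real \<Rightarrow> real ^ 3) \<Rightarrow> 'v sgraph \<Rightarrow> (real ^ 3) set" where
  "realization p g \<Theta> = p ` verts \<Theta> \<union> (\<Union>e\<in>edges \<Theta>. path_image (g e))"

text \<open>For a finite graph with embedding \<open>(p, g)\<close>, the realization of a subgraph is homeomorphic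
  to the geometric realization of the abstract subgraph, so being a cycle does not depend on
  the embedding.\<close>

definition is_cycle ::
    "'v sgraph \<Rightarrow> ('v \<Rightarrow> real ^ 3) \<Rightarrow> ('v set \<Rightarrow> real \<Rightarrow> real ^ 3) \<Rightarrow> 'v sgraph \<Rightarrow> bool" where
  "is_cycle \<Theta> p g C \<longleftrightarrow>
     subgraph C \<Theta> \<and> realization p g C homeomorphic (sphere 0 1 :: (real ^ 2) set)"

definition has_Hamilton_cycle ::
    "'v sgraph \<Rightarrow> ('v \<Rightarrow> real ^ 3) \<Rightarrow> ('v set \<Rightarrow> real \<Rightarrow> real ^ 3) \<Rightarrow> bool" where
  "has_Hamilton_cycle \<Theta> p g \<longleftrightarrow> (\<exists>C. is_cycle \<Theta> p g C \<and> verts \<Theta> \<subseteq> verts C)"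

definition faces ::
    "'v sgraph \<Rightarrow> ('v \<Rightarrow> real ^ 3) \<Rightarrow> ('v set \<Rightarrow> real \<Rightarrow> real ^ 3) \<Rightarrow> (real ^ 3) set set" where
  "faces \<Theta> p g = components (S2 - realization p g \<Theta>)"

text \<open>The boundary of a face is its frontier relative to the sphere.\<close>

definition vertex_face_graph ::
    "'v sgraph \<Rightarrow> ('v \<Rightarrow> real ^ 3) \<Rightarrow> ('v set \<Rightarrow> real \<Rightarrow> real ^ 3) \<Rightarrow> ('v + (real ^ 3) set) sgraph" where
  "vertex_face_graph \<Theta> p g =
     \<lparr>verts = verts \<Theta> <+> faces \<Theta> p g,
      edges = {{Inl v, Inr f} | v f.
        v \<in> verts \<Theta> \<and> f \<in> faces \<Theta> p g \<and> p v \<in> (top_of_set S2) frontier_of f}\<rparr>"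

end

theory Submission
  imports Defs "HOL-Complex_Analysis.Contour_Integration"
begin

text \<open>
The topology of the sphere enters mainly through one statement, \<open>arc_splits_component\<close>: if an arc runs
through a component of the complement of a compact set \<open>X\<close>, and its end points lie in \<open>X\<close> and are
joined by an arc inside \<open>X\<close>, then it cuts that component into exactly two pieces, and the whole arc
lies in the closure of both.  The arc and its companion in \<open>X\<close> form a Jordan curve, which provides
the two pieces; that each piece is connected is Janiszewski's theorem, since the curve
meets \<open>X\<close> in a connected set.

In a 2-connected cubic graph both ends of an edge stay joined when the edge is removed, so every
edge borders exactly two faces.  At a vertex \<open>v\<close> of a cubic graph, the first cut is along the path formed by
two of the three edges, inside the component that contains \<open>v\<close> of the complement of \<open>\<Theta> - v\<close>; the
second cut is along the third edge.  Hence \<open>v\<close> lies on exactly three faces, and the three edges at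
\<open>v\<close> border the three pairs of them (\<open>vertex_triangle\<close>).  The rest of the argument uses these facts
and the Jordan curve theorem.

A Hamilton cycle is a Jordan curve with sides \<open>D\<^sub>1\<close>, \<open>D\<^sub>2\<close>.  The edges off the cycle, its chords, are
pairwise disjoint; let \<open>W\<close> be a set of vertices, neither empty nor everything, that contains exactly
one end of every chord.  The faces in \<open>D\<^sub>1\<close> are linked to
each other across the chords in \<open>D\<^sub>1\<close>, and therefore through vertices in \<open>W\<close>, and equally well
through vertices outside \<open>W\<close>.  So \<open>W\<close> together with the faces in \<open>D\<^sub>1\<close> is a strongly legal state, and it
remains legal when \<open>W\<close> is replaced by its complement.  This makes the system legal that moves all
vertices of \<open>\<Theta>\<close> at once, or all faces at once (\<open>Hamilton_cycle_states\<close>).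

Conversely, a strongly legal state \<open>S\<close> colours the faces in two colours, and both colours occur at every
vertex.  By the triangle property exactly two edges at each vertex separate the colours, so the
separating edges contain a cycle.  Suppose this cycle misses a vertex.  Each colour class of faces
stays on one side of the cycle, because \<open>S\<close> and its complement are connected and at every vertex faces
of the same colour are adjacent across an edge that does not separate colours; and a separating
edge at the missed vertex puts both classes on the same side.  Then the other side contains no face, which
contradicts the Jordan curve theorem (\<open>strongly_legal_imp_Hamilton_cycle\<close>).

That a legal system produces a strongly legal state is pure combinatorics: if some vertex of a
state in the orbit had no neighbour in the complement, a move would turn the state into a
singleton or the complement of one, and two further moves would give a disconnected state as soon
as every vertex has two non-neighbours (\<open>legal_system_imp_strongly_legal\<close>).
\<close>

section \<open>Jordan and Janiszewski on the sphere\<close>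

lemma punctured_S2_homeomorphism:
  assumes "x \<in> S2"
  obtains h k where "homeomorphism (S2 - {x}) (UNIV :: complex set) h k"
proof -
  have "(S2 - {x}) homeomorphic (UNIV :: complex set)"
    using assms by (intro homeomorphic_punctured_sphere_affine) auto
  then show ?thesis
    using that by (auto simp: homeomorphic_def)
qed

lemma connected_punctured_S2: "connected (S2 - {x})"
proof (cases "x \<in> S2")
  case True
  then have "(S2 - {x}) homeomorphic (UNIV :: complex set)"
    by (intro homeomorphic_punctured_sphere_affine) auto
  then show ?thesis
    using homeomorphic_connectedness connected_UNIV by blast
next
  case False
  then show ?thesis
    by (simp add: connected_sphere)
qed

lemma infinite_openin_S2:
  assumes "openin (top_of_set S2) U" "U \<noteq> {}"
  shows "infinite U"
proof
  assume fin: "finite U"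
  have "closed U"
    using fin by (rule finite_imp_closed)
  then have "closedin (top_of_set S2) U"
    using assms(1) by (meson closed_subset openin_imp_subset)
  then have "U = S2"
    using assms connected_clopen[of S2] connected_sphere[of "0 :: real ^ 3" 1] by fastforce
  moreover have "infinite S2"
  proof
    assume "finite S2"
    obtain x :: "real ^ 3" where "x \<in> S2"
      using sphere_eq_empty[of "0 :: real ^ 3" 1] by fastforce
    then obtain h k where "homeomorphism (S2 - {x}) (UNIV :: complex set) h k"
      using punctured_S2_homeomorphism by blast
    then have "h ` (S2 - {x}) = (UNIV :: complex set)"
      by (simp add: homeomorphism_def)
    then have "finite (UNIV :: complex set)"
      using \<open>finite S2\<close> by (metis finite_Diff finite_imageI)
    then show False
      by (simp add: infinite_UNIV_char_0)
  qed
  ultimately show False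
    using fin by simp
qed

text \<open>
The region either is the whole sphere or misses a point, from which stereographic projection
reduces the claim to an open connected set in the plane.
\<close>

lemma openin_S2_delete_connected:
  assumes op: "openin (top_of_set S2) W" and conn: "connected W"
  shows "connected (W - {x})"
proof (cases "W = S2")
  case True
  then show ?thesis
    by (simp add: connected_punctured_S2)
next
  case False
  then obtain y where y: "y \<in> S2" "y \<notin> W"
    using openin_imp_subset[OF op] by blast
  obtain h k where hk: "homeomorphism (S2 - {y}) (UNIV :: complex set) h k"
    using punctured_S2_homeomorphism[OF y(1)] .
  have W: "W \<subseteq> S2 - {y}"
    using y openin_imp_subset[OF op] by auto
  have homW: "homeomorphism W (h ` W) h k"
    using homeomorphism_of_subsets[OF hk W] by simp
  show ?thesis
  proof (cases "x \<in> W")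
    case True
    have "openin (top_of_set (S2 - {y})) W"
      using op W by (meson Diff_subset openin_subset_trans)
    then have "open (h ` W)"
      using homeomorphism_imp_open_map[OF hk] by simp
    moreover have "connected (h ` W)"
      using homW conn homeomorphic_connectedness homeomorphic_def by blast
    ultimately have c: "connected (h ` W - {h x})"
      by (intro connected_open_delete) auto
    have "h ` (W - {x}) = h ` W - {h x}"
      using homW True by (auto simp: homeomorphism_def) (metis)
    then have "homeomorphism (W - {x}) (h ` W - {h x}) h k"
      using homeomorphism_of_subsets[OF homW, of "W - {x}" "h ` W"] by auto
    then show ?thesis
      using c homeomorphic_connectedness homeomorphic_def by blast
  qed (use conn in simp)
qed

lemma openin_S2_Diff:
  "compact X \<Longrightarrow> openin (top_of_set S2) (S2 - X)" for X :: "(real ^ 3) set"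
  by (simp add: compact_imp_closed Diff_eq openin_open_Int open_Compl)

text \<open>
Project the sphere to the plane from a point \<open>x\<close> outside \<open>A \<union> B\<close> that differs from \<open>a\<close> and \<open>b\<close>.  The
components of the complements of \<open>A\<close> and of \<open>B\<close> that contain \<open>a\<close> and \<open>b\<close> may pass through \<open>x\<close>, but they
remain connected when \<open>x\<close> is removed, so the planar theorem applies.
\<close>

lemma Janiszewski_S2:
  fixes a b :: "real ^ 3"
  assumes "compact A" "compact B" "A \<subseteq> S2" "B \<subseteq> S2" "connected (A \<inter> B)"
    and A: "connected_component (S2 - A) a b" and B: "connected_component (S2 - B) a b"
  shows "connected_component (S2 - (A \<union> B)) a b"
proof -
  define O' where "O' = S2 - (A \<union> B)"
  have ab: "a \<in> O'" "b \<in> O'"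
    using A B by (auto simp: O'_def dest: connected_component_in)
  have "infinite O'"
    unfolding O'_def using ab openin_S2_Diff[OF compact_Un[OF assms(1,2)]]
    by (intro infinite_openin_S2) (auto simp: O'_def)
  then have "infinite (O' - {a, b})"
    by simp
  then obtain x where x: "x \<in> O' - {a,b}"
    using infinite_imp_nonempty by blast
  then have xS: "x \<in> S2"
    by (auto simp: O'_def)
  obtain h k where hk: "homeomorphism (S2 - {x}) (UNIV :: complex set) h k"
    using punctured_S2_homeomorphism[OF xS] .
  note h = homeomorphism_cont1[OF hk] and k = homeomorphism_cont2[OF hk]
    and kh = homeomorphism_apply1[OF hk] and hk' = homeomorphism_apply2[OF hk UNIV_I]
  have k_in: "k z \<in> S2 - {x}" for z
    using homeomorphism_image2[OF hk] by blast
  have sub: "A \<subseteq> S2 - {x}" "B \<subseteq> S2 - {x}"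
    using x assms by (auto simp: O'_def)
  have cmp: "compact (h ` A)" "compact (h ` B)"
    using sub h assms(1,2) by (meson compact_continuous_image continuous_on_subset)+
  have inj_h: "inj_on h (S2 - {x})"
    by (rule inj_on_inverseI[of _ k]) (rule kh)
  have Int: "h ` A \<inter> h ` B = h ` (A \<inter> B)"
    using inj_on_image_Int[OF inj_h sub] by simp
  have cInt: "connected (h ` A \<inter> h ` B)"
    unfolding Int using h sub assms(5)
    by (intro connected_continuous_image) (auto intro: continuous_on_subset)
  have move: "connected_component (- h ` X) (h a) (h b)"
    if X: "compact X" "X \<subseteq> S2 - {x}" and cX: "connected_component (S2 - X) a b" for X
  proof -
    define W where "W = connected_component_set (S2 - X) a"
    have "openin (top_of_set S2) W"
    proof -
      have "locally connected S2"
        using locally_connected_sphere by blast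
      then have "locally connected (S2 - X)"
        using locally_open_subset openin_S2_Diff[OF X(1)] by blast
      then have "openin (top_of_set (S2 - X)) W"
        unfolding W_def by (simp add: openin_connected_component_locally_connected)
      then show ?thesis
        using openin_S2_Diff[OF X(1)] openin_trans by blast
    qed
    moreover have "connected W"
      by (simp add: W_def)
    ultimately have c: "connected (W - {x})"
      by (rule openin_S2_delete_connected)
    have Wsub: "W \<subseteq> S2 - X"
      by (simp add: W_def connected_component_subset)
    have "connected (h ` (W - {x}))"
      using c Wsub h by (intro connected_continuous_image) (auto intro: continuous_on_subset)
    moreover have "h ` (W - {x}) \<subseteq> - h ` X"
    proof -
      have "h ` (W - {x}) \<inter> h ` X = h ` ((W - {x}) \<inter> X)"
        using inj_on_image_Int[OF inj_h, of "W - {x}" X] X(2) Wsub by blast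
      also have "(W - {x}) \<inter> X = {}"
        using Wsub by blast
      finally show ?thesis
        by blast
    qed
    moreover have "a \<in> W - {x}" "b \<in> W - {x}"
      using x cX by (auto simp: W_def connected_component_in dest: connected_component_in)
    ultimately show ?thesis
      unfolding connected_component_def by blast
  qed
  have "connected_component (- (h ` A \<union> h ` B)) (h a) (h b)"
    using cmp cInt move[OF assms(1) sub(1) A] move[OF assms(2) sub(2) B]
    by (intro Janiszewski) (auto simp: compact_imp_closed)
  then obtain T where T: "connected T" "T \<subseteq> - (h ` A \<union> h ` B)" "h a \<in> T" "h b \<in> T"
    unfolding connected_component_def by blast
  have "connected (k ` T)"
    using T(1) k by (meson connected_continuous_image continuous_on_subset subset_UNIV)
  moreover have "k ` T \<subseteq> S2 - (A \<union> B)"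
  proof clarify
    fix t assume "t \<in> T"
    then have "h (k t) \<notin> h ` A \<union> h ` B"
      using T(2) unfolding hk' by blast
    then show "k t \<in> S2 - (A \<union> B)"
      using k_in[of t] by blast
  qed
  moreover have "k (h a) = a" "k (h b) = b"
    using kh[of a] kh[of b] ab x unfolding O'_def by blast+
  ultimately show ?thesis
    unfolding connected_component_def using T(3,4) by (intro exI[of _ "k ` T"]) (metis imageI)
qed

text \<open>
Remove a point: a punctured circle is a line, whereas a punctured sphere is a plane.
\<close>

lemma circle_neq_S2:
  fixes K :: "(real ^ 3) set"
  assumes "K homeomorphic (sphere 0 1 :: complex set)"
  shows "K \<noteq> S2"
proof
  assume K: "K = S2"
  obtain f g where fg: "homeomorphism S2 (sphere 0 1 :: complex set) f g"
    using assms K by (auto simp: homeomorphic_def)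
  define x :: "real ^ 3" where "x = (SOME x. x \<in> S2)"
  have x: "x \<in> S2"
    unfolding x_def using someI_ex[of "\<lambda>x. x \<in> S2"] sphere_eq_empty[of "0 :: real ^ 3" 1] by fastforce
  have "inj_on f S2"
    by (rule inj_on_inverseI[of _ g]) (rule homeomorphism_apply1[OF fg])
  moreover have "f ` S2 = sphere 0 1"
    using fg by (rule homeomorphism_image1)
  ultimately have "f ` (S2 - {x}) = sphere 0 1 - {f x}"
    using inj_on_image_set_diff[of f S2 S2 "{x}"] x by simp
  then have "homeomorphism (S2 - {x}) (sphere 0 1 - {f x}) f g"
    using homeomorphism_of_subsets[OF fg, of "S2 - {x}" "sphere 0 1"] by auto
  then have 1: "(S2 - {x}) homeomorphic (sphere 0 1 - {f x})"
    by (auto simp: homeomorphic_def)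
  have 2: "(S2 - {x}) homeomorphic (UNIV :: complex set)"
    using x by (intro homeomorphic_punctured_sphere_affine) auto
  have "f x \<in> sphere 0 1"
    using homeomorphism_image1[OF fg] x by blast
  then have 3: "(sphere 0 1 - {f x}) homeomorphic (UNIV :: real set)"
    by (intro homeomorphic_punctured_sphere_affine) auto
  have "(UNIV :: complex set) homeomorphic (UNIV :: real set)"
    by (rule homeomorphic_trans[OF homeomorphic_trans[OF homeomorphic_sym[THEN iffD1, OF 2] 1] 3])
  then show False
    by (simp add: homeomorphic_UNIV_UNIV)
qed

text \<open>
Project from a point \<open>x\<close> off the curve.  One side is the inside of the planar curve; the other is its
outside together with \<open>x\<close>, which is a limit of the outside because the inside is bounded.
\<close>

lemma Jordan_S2:
  fixes \<gamma> :: "real \<Rightarrow> real ^ 3"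
  assumes \<gamma>: "simple_path \<gamma>" "pathfinish \<gamma> = pathstart \<gamma>" and sub: "path_image \<gamma> \<subseteq> S2"
  obtains D1 D2 where "D1 \<noteq> {}" "D2 \<noteq> {}" "D1 \<inter> D2 = {}" "D1 \<union> D2 = S2 - path_image \<gamma>"
    "connected D1" "connected D2" "openin (top_of_set S2) D1" "openin (top_of_set S2) D2"
    "path_image \<gamma> \<subseteq> closure D1" "path_image \<gamma> \<subseteq> closure D2"
proof -
  have "path_image \<gamma> homeomorphic (sphere 0 1 :: complex set)"
    using \<gamma> by (intro homeomorphic_simple_path_image_circle) auto
  then have "path_image \<gamma> \<noteq> S2"
    by (rule circle_neq_S2)
  then obtain x where x: "x \<in> S2" "x \<notin> path_image \<gamma>"
    using sub by blast
  obtain h k where hk: "homeomorphism (S2 - {x}) (UNIV :: complex set) h k"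
    using punctured_S2_homeomorphism[OF x(1)] .
  note h = homeomorphism_cont1[OF hk] and k = homeomorphism_cont2[OF hk]
    and kh = homeomorphism_apply1[OF hk] and hk' = homeomorphism_apply2[OF hk UNIV_I]
  have k_in: "k z \<in> S2 - {x}" for z
    using homeomorphism_image2[OF hk] by blast
  have kinj: "inj k"
    by (rule inj_on_inverseI[of _ h]) (rule hk')
  define c where "c = h \<circ> \<gamma>"
  have pis: "path_image \<gamma> \<subseteq> S2 - {x}"
    using x sub by auto
  have "inj_on h (S2 - {x})"
    by (rule inj_on_inverseI[of _ k]) (rule kh)
  then have c: "simple_path c"
    unfolding c_def using \<gamma>(1) h pis
    by (intro simple_path_continuous_image) (auto intro: continuous_on_subset inj_on_subset)
  have cl: "pathfinish c = pathstart c"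
    using \<gamma>(2) by (simp add: c_def pathfinish_def pathstart_def)
  have kc: "k ` path_image c = path_image \<gamma>"
  proof -
    have "k ` path_image c = (\<lambda>y. k (h y)) ` path_image \<gamma>"
      by (simp add: c_def path_image_compose image_image)
    also have "\<dots> = (\<lambda>y. y) ` path_image \<gamma>"
      using pis by (intro image_cong refl kh) blast
    finally show ?thesis
      by simp
  qed
  let ?I = "inside (path_image c)" and ?O = "outside (path_image c)"
  have J: "?I \<noteq> {}" "open ?I" "connected ?I" "?O \<noteq> {}" "open ?O" "connected ?O" "bounded ?I"
    "?I \<inter> ?O = {}" "?I \<union> ?O = - path_image c"
    "frontier ?I = path_image c" "frontier ?O = path_image c"
    by (insert Jordan_inside_outside[OF c cl], (elim conjE, assumption)+)
  define D1 where "D1 = k ` ?I"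
  define D2 where "D2 = insert x (k ` ?O)"
  have kU: "k ` UNIV = S2 - {x}"
    using hk by (rule homeomorphism_image2)
  have "k ` (?I \<union> ?O) = k ` (UNIV - path_image c)"
    unfolding J Compl_eq_Diff_UNIV ..
  also have "\<dots> = (S2 - {x}) - path_image \<gamma>"
    unfolding image_set_diff[OF kinj] kU kc ..
  finally have un: "k ` ?I \<union> k ` ?O = (S2 - {x}) - path_image \<gamma>"
    unfolding image_Un .
  have union: "D1 \<union> D2 = S2 - path_image \<gamma>"
    unfolding D1_def D2_def using un x by blast
  have dis0: "k ` ?I \<inter> k ` ?O = {}"
    unfolding image_Int[OF kinj, symmetric] J by (rule image_empty)
  have dis: "D1 \<inter> D2 = {}"
    unfolding D1_def D2_def using dis0 k_in by blast
  have hom': "homeomorphism UNIV (S2 - {x}) k h"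
    by (rule homeomorphism_sym[THEN iffD1, OF hk])
  have opx: "openin (top_of_set S2) (S2 - {x})"
    by (simp add: openin_S2_Diff)
  have op1: "openin (top_of_set S2) D1"
  proof -
    have "openin (top_of_set (S2 - {x})) D1"
      unfolding D1_def using J(2) by (intro homeomorphism_imp_open_map[OF hom']) simp
    then show ?thesis
      using opx openin_trans by blast
  qed
  have clI: "closure ?I = ?I \<union> path_image c" and clO: "closure ?O = ?O \<union> path_image c"
    using closure_Un_frontier[of ?I] closure_Un_frontier[of ?O] unfolding J by blast+
  have "compact (closure ?I)"
    using J(7) by (simp add: compact_closure)
  then have "compact (k ` closure ?I)"
    using k by (meson compact_continuous_image continuous_on_subset subset_UNIV)
  moreover have "D2 = S2 - k ` closure ?I"
    using union dis k_in x unfolding clI image_Un kc D1_def by blast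
  ultimately have op2: "openin (top_of_set S2) D2"
    by (simp add: openin_S2_Diff)
  have conn1: "connected D1"
    unfolding D1_def using J(3,6) k by (meson connected_continuous_image continuous_on_subset subset_UNIV)
  have connO: "connected (k ` ?O)"
    using J(3,6) k by (meson connected_continuous_image continuous_on_subset subset_UNIV)
  have "D2 - {x} = k ` ?O"
    unfolding D2_def using k_in by blast
  moreover have "connected D2"
  proof -
    have "x \<in> closure (k ` ?O)"
    proof (rule ccontr)
      assume "x \<notin> closure (k ` ?O)"
      then have "openin (top_of_set S2) (D2 \<inter> (S2 \<inter> - closure (k ` ?O)))"
        using op2 by (intro openin_Int openin_open_Int) auto
      moreover have "D2 \<inter> (S2 \<inter> - closure (k ` ?O)) = {x}"
        using \<open>x \<notin> closure _\<close> x closure_subset[of "k ` ?O"] by (auto simp: D2_def)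
      ultimately show False
        using infinite_openin_S2 by (metis finite.emptyI finite_insert insert_not_empty)
    qed
    then show ?thesis
      using connected_intermediate_closure[OF connO, of D2] closure_subset[of "k ` ?O"]
      by (auto simp: D2_def)
  qed
  moreover have cl1: "path_image \<gamma> \<subseteq> closure D1"
  proof -
    have "k ` closure ?I \<subseteq> closure (k ` ?I)"
      by (rule image_closure_subset[OF continuous_on_subset[OF k] closed_closure closure_subset]) simp
    then show ?thesis
      using kc by (auto simp: clI D1_def)
  qed
  moreover have cl2: "path_image \<gamma> \<subseteq> closure D2"
  proof -
    have "k ` closure ?O \<subseteq> closure (k ` ?O)"
      by (rule image_closure_subset[OF continuous_on_subset[OF k] closed_closure closure_subset]) simp
    also have "\<dots> \<subseteq> closure D2"
      by (intro closure_mono) (auto simp: D2_def)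
    finally show ?thesis
      using kc by (auto simp: clO)
  qed
  moreover have "D1 \<noteq> {}" "D2 \<noteq> {}"
    using J(1) by (auto simp: D1_def D2_def)
  ultimately show ?thesis
    using that union dis op1 op2 conn1 by blast
qed

text \<open>
Cycles are described up to homeomorphism, whereas Jordan's theorem speaks of a parametrized
curve.
\<close>

lemma circle_imp_loop:
  fixes K :: "(real ^ 3) set"
  assumes "K homeomorphic (sphere 0 1 :: (real ^ 2) set)"
  obtains \<gamma> where "simple_path \<gamma>" "pathfinish \<gamma> = pathstart \<gamma>" "path_image \<gamma> = K"
proof -
  have "(sphere 0 1 :: (real ^ 2) set) homeomorphic (sphere 0 1 :: complex set)"
    by (intro homeomorphic_spheres_gen) auto
  then have "(sphere 0 1 :: complex set) homeomorphic K"
    using assms homeomorphic_trans homeomorphic_sym by blast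
  then obtain f h where fh: "homeomorphism (sphere 0 1 :: complex set) K f h"
    by (auto simp: homeomorphic_def)
  have img: "path_image (circlepath 0 1) = (sphere 0 1 :: complex set)"
    by simp
  have inj: "inj_on f (sphere 0 1)"
    by (rule inj_on_inverseI[of _ h]) (rule homeomorphism_apply1[OF fh])
  have 1: "simple_path (f \<circ> circlepath 0 1)"
    using homeomorphism_cont1[OF fh] inj
    by (intro simple_path_continuous_image) (simp_all add: simple_path_circlepath)
  have 2: "pathfinish (f \<circ> circlepath 0 1) = pathstart (f \<circ> circlepath 0 1)"
    by (simp add: pathfinish_compose pathstart_compose)
  have 3: "path_image (f \<circ> circlepath 0 1) = K"
    unfolding path_image_compose img by (rule homeomorphism_image1[OF fh])
  show ?thesis
    by (rule that[OF 1 2 3])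
qed

lemma loop_imp_circle:
  fixes \<gamma> :: "real \<Rightarrow> real ^ 3"
  assumes "simple_path \<gamma>" "pathfinish \<gamma> = pathstart \<gamma>"
  shows "path_image \<gamma> homeomorphic (sphere 0 1 :: (real ^ 2) set)"
proof -
  have "path_image \<gamma> homeomorphic (sphere 0 1 :: complex set)"
    using assms by (intro homeomorphic_simple_path_image_circle) auto
  moreover have "(sphere 0 1 :: complex set) homeomorphic (sphere 0 1 :: (real ^ 2) set)"
    by (intro homeomorphic_spheres_gen) auto
  ultimately show ?thesis
    by (rule homeomorphic_trans)
qed

lemma circle_delete_connected:
  fixes K :: "(real ^ 3) set"
  assumes K: "K homeomorphic (sphere 0 1 :: (real ^ 2) set)" and x: "x \<in> K"
  shows "connected (K - {x})"
proof -
  obtain f h where fh: "homeomorphism K (sphere 0 1 :: (real ^ 2) set) f h"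
    using K by (auto simp: homeomorphic_def)
  have inj: "inj_on f K"
    by (rule inj_on_inverseI[of _ h]) (rule homeomorphism_apply1[OF fh])
  have fK: "f ` K = sphere 0 1"
    by (rule homeomorphism_image1[OF fh])
  have "f x \<in> sphere 0 1"
    using fK x by blast
  then have "(sphere 0 1 - {f x}) homeomorphic (UNIV :: real set)"
    by (intro homeomorphic_punctured_sphere_affine) auto
  moreover have "f ` (K - {x}) = sphere 0 1 - {f x}"
    using inj_on_image_set_diff[OF inj, of K "{x}"] x fK by simp
  then have "homeomorphism (K - {x}) (sphere 0 1 - {f x}) f h"
    by (intro homeomorphism_of_subsets[OF fh, of _ "sphere 0 1"]) auto
  then have "(K - {x}) homeomorphic (sphere 0 1 - {f x})"
    by (auto simp: homeomorphic_def)
  ultimately show ?thesis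
    using homeomorphic_connectedness connected_UNIV by metis
qed

section \<open>Cutting a region along an arc\<close>

definition open_arc :: "(real \<Rightarrow> 'a::topological_space) \<Rightarrow> 'a set" where
  "open_arc c = path_image c - {pathstart c, pathfinish c}"

lemma open_arc_eq:
  assumes "arc c"
  shows "open_arc c = c ` {0<..<1}"
proof -
  have inj: "inj_on c {0..1}"
    using assms by (simp add: arc_def)
  have "c ` {0<..<1} = c ` ({0..1} - {0, 1})"
    by (rule arg_cong[of _ _ "image c"]) auto
  also have "\<dots> = c ` {0..1} - c ` {0, 1}"
    by (rule inj_on_image_set_diff[OF inj]) auto
  finally show ?thesis
    by (simp add: open_arc_def path_image_def pathstart_def pathfinish_def)
qed

lemma connected_open_arc:
  assumes "arc c"
  shows "connected (open_arc c)"
proof -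
  have "continuous_on {0<..<1} c"
    by (rule continuous_on_subset[of "{0..1}"]) (use assms in \<open>auto simp: arc_def path_def\<close>)
  then show ?thesis
    unfolding open_arc_eq[OF assms] by (intro connected_continuous_image) auto
qed

lemma open_arc_nonempty: "arc c \<Longrightarrow> open_arc c \<noteq> {}"
  by (simp add: open_arc_eq)

lemma path_image_subset_closure_open_arc:
  fixes c :: "real \<Rightarrow> 'a::metric_space"
  assumes "arc c"
  shows "path_image c \<subseteq> closure (open_arc c)"
proof -
  have "c ` closure {0<..<1} \<subseteq> closure (open_arc c)"
    unfolding open_arc_eq[OF assms]
    by (rule image_closure_subset[OF _ closed_closure closure_subset])
      (use assms in \<open>simp add: arc_def path_def\<close>)
  then show ?thesis
    by (simp add: path_image_def)
qed

text \<open>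
The standard way below to recognise a face: if its closure reaches into an open region, then so
does the face itself.
\<close>

lemma openin_meets_closure:
  assumes "openin (top_of_set T) W" "A \<subseteq> T" "W \<inter> closure A \<noteq> {}"
  shows "W \<inter> A \<noteq> {}"
proof -
  obtain O' where O': "open O'" "W = T \<inter> O'"
    using assms(1) by (auto simp: openin_open)
  then have "O' \<inter> closure A \<noteq> {}"
    using assms(3) by blast
  then have "O' \<inter> A \<noteq> {}"
    using open_Int_closure_eq_empty[OF O'(1)] by blast
  then show ?thesis
    using O' assms(2) by blast
qed

lemma openin_component_S2_Diff:
  fixes X :: "(real ^ 3) set"
  assumes "compact X" "W \<in> components (S2 - X)"
  shows "openin (top_of_set S2) W"
proof -
  have "locally connected S2"
    using locally_connected_sphere by blast
  then have "locally connected (S2 - X)"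
    using locally_open_subset openin_S2_Diff[OF assms(1)] by blast
  then have "openin (top_of_set (S2 - X)) W"
    using assms(2) openin_components_locally_connected by blast
  then show ?thesis
    using openin_S2_Diff[OF assms(1)] openin_trans by blast
qed

text \<open>
Used for faces and edges, which lie entirely on one side of a Jordan curve that avoids them.
\<close>

lemma connected_subset_openin_part:
  assumes "openin (top_of_set T) D" "openin (top_of_set T) D'" "D \<inter> D' = {}"
    and "connected U" "U \<subseteq> D \<union> D'" "U \<inter> D \<noteq> {}"
  shows "U \<subseteq> D"
proof -
  obtain A A' where A: "open A" "D = T \<inter> A" "open A'" "D' = T \<inter> A'"
    using assms(1,2) by (auto simp: openin_open)
  have "A \<inter> U = {} \<or> A' \<inter> U = {}"
    using A assms(3,5) by (intro connectedD[OF assms(4)]) blast+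
  then show ?thesis
    using A assms(3,5,6) by blast
qed

text \<open>
Let \<open>J\<close> be the Jordan curve \<open>c \<union> P\<close>, with sides \<open>D1\<close> and \<open>D2\<close>.  The pieces are \<open>W \<inter> D1\<close> and
\<open>W \<inter> D2\<close>.  They reach every point of the open arc since \<open>J\<close> is in the closure of both sides.  Two
points of \<open>W \<inter> D1\<close> are separated neither by \<open>X\<close> nor by \<open>J\<close>, and \<open>X \<inter> J = P\<close> is connected, so by
Janiszewski's theorem they are not separated by \<open>X \<union> J = X \<union> c\<close>.
\<close>

lemma arc_splits_component:
  fixes X :: "(real ^ 3) set" and c P :: "real \<Rightarrow> real ^ 3"
  assumes X: "compact X" "X \<subseteq> S2"
    and c: "arc c" "path_image c \<subseteq> S2" "path_image c \<inter> X = {pathstart c, pathfinish c}"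
    and P: "arc P" "path_image P \<subseteq> X" "pathstart P = pathfinish c" "pathfinish P = pathstart c"
    and W: "W \<in> components (S2 - X)" "W \<inter> open_arc c \<noteq> {}"
  obtains U1 U2 where "U1 \<noteq> U2" "U1 \<in> components (S2 - (X \<union> path_image c))"
    "U2 \<in> components (S2 - (X \<union> path_image c))" "W - path_image c = U1 \<union> U2"
    "path_image c \<subseteq> closure U1" "path_image c \<subseteq> closure U2"
proof -
  let ?L = "path_image c"
  let ?J = "path_image (c +++ P)"
  have J_eq: "?J = ?L \<union> path_image P"
    using P(3) by (simp add: path_image_join)
  have LP: "?L \<inter> path_image P = {pathstart c, pathfinish c}"
  proof
    show "?L \<inter> path_image P \<subseteq> {pathstart c, pathfinish c}"
      using c(3) P(2) by blast
    show "{pathstart c, pathfinish c} \<subseteq> ?L \<inter> path_image P"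
      using P(3,4) pathstart_in_path_image pathfinish_in_path_image by (metis Int_iff empty_subsetI insert_subset)
  qed
  have sp: "simple_path (c +++ P)"
    using c(1) P LP by (intro simple_path_join_loop) auto
  have J_S2: "?J \<subseteq> S2"
    using J_eq c(2) P(2) X(2) by blast
  obtain D1 D2 where D: "D1 \<noteq> {}" "D2 \<noteq> {}" "D1 \<inter> D2 = {}" "D1 \<union> D2 = S2 - ?J"
    "connected D1" "connected D2" "openin (top_of_set S2) D1" "openin (top_of_set S2) D2"
    "?J \<subseteq> closure D1" "?J \<subseteq> closure D2"
    by (rule Jordan_S2[OF sp _ J_S2]) (use P in simp)
  have XJ: "X \<union> ?J = X \<union> ?L" and XJ': "X \<inter> ?J = path_image P"
    using J_eq P(2) c(3) LP by blast+
  have cJ: "compact ?J"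
    using sp by (simp add: compact_simple_path_image)
  have W_op: "openin (top_of_set S2) W"
    using openin_component_S2_Diff[OF X(1) W(1)] .
  have W_sub: "W \<subseteq> S2 - X"
    using W(1) by (rule in_components_subset)
  have W_conn: "connected W"
    using W(1) by (rule in_components_connected)
  have "open_arc c \<subseteq> S2 - X"
    using c unfolding open_arc_def by blast
  then have L_W: "open_arc c \<subseteq> W"
    using components_maximal[OF W(1) connected_open_arc[OF c(1)]] W(2) by blast
  have key: "W \<inter> D \<in> components (S2 - (X \<union> ?L)) \<and> ?L \<subseteq> closure (W \<inter> D)"
    if "connected D" "D \<subseteq> S2 - ?J" "?J \<subseteq> closure D" "D \<union> D' = S2 - ?J" "D \<inter> D' = {}"
      "openin (top_of_set S2) D" "openin (top_of_set S2) D'" for D D'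
  proof
    have D_S2: "D \<subseteq> S2"
      using that by blast
    have near: "W \<inter> D \<inter> V \<noteq> {}" if V: "openin (top_of_set S2) V" "y \<in> V" "y \<in> open_arc c" for V y
    proof -
      have "(W \<inter> V) \<inter> D \<noteq> {}"
      proof (rule openin_meets_closure[OF openin_Int[OF W_op V(1)] D_S2])
        have "y \<in> closure D"
          using V(3) \<open>?J \<subseteq> closure D\<close> J_eq unfolding open_arc_def by blast
        then show "W \<inter> V \<inter> closure D \<noteq> {}"
          using V L_W by blast
      qed
      then show ?thesis
        by blast
    qed
    obtain y where y: "y \<in> open_arc c"
      using open_arc_nonempty[OF c(1)] by blast
    then have "W \<inter> D \<inter> W \<noteq> {}"
      using near[OF W_op] L_W by blast
    then obtain a where a: "a \<in> W" "a \<in> D"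
      by blast
    define U where "U = connected_component_set (S2 - (X \<union> ?L)) a"
    have "a \<in> S2 - (X \<union> ?L)"
      using a W_sub that(2) J_eq by blast
    then have U: "U \<in> components (S2 - (X \<union> ?L))" and aU: "a \<in> U"
      unfolding U_def by (auto intro: componentsI)
    have U_conn: "connected U" and U_sub: "U \<subseteq> S2 - (X \<union> ?L)"
      using in_components_connected[OF U] in_components_subset[OF U] .
    have "U \<subseteq> W"
      using components_maximal[OF W(1) U_conn] U_sub aU a by blast
    moreover have "U \<subseteq> D"
    proof -
      have "U \<subseteq> D \<union> D'"
        unfolding that(4) using U_sub XJ by blast
      then show ?thesis
        using connected_subset_openin_part[OF that(6,7,5) U_conn] aU a by blast
    qed
    moreover have "W \<inter> D \<subseteq> U"
    proof
      fix b assume b: "b \<in> W \<inter> D"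
      have 1: "connected_component (S2 - X) a b"
        unfolding connected_component_def using a b W_conn W_sub by blast
      have 2: "connected_component (S2 - ?J) a b"
        unfolding connected_component_def using a b that(1,2) by blast
      have "connected_component (S2 - (X \<union> ?J)) a b"
        by (rule Janiszewski_S2[OF X(1) cJ X(2) J_S2 _ 1 2])
          (simp add: XJ' connected_path_image arc_imp_path P(1))
      then show "b \<in> U"
        by (simp add: U_def XJ)
    qed
    ultimately have "U = W \<inter> D"
      by blast
    then show "W \<inter> D \<in> components (S2 - (X \<union> ?L))"
      using U by simp
    have "open_arc c \<subseteq> closure (W \<inter> D)"
    proof
      fix y assume y: "y \<in> open_arc c"
      show "y \<in> closure (W \<inter> D)"
        unfolding closure_iff_nhds_not_empty
      proof (intro allI impI)
        fix A V :: "(real ^ 3) set"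
        assume "V \<subseteq> A" "y \<in> V" "open V"
        moreover have "y \<in> S2"
          using y c(2) unfolding open_arc_def by blast
        ultimately have "W \<inter> D \<inter> (S2 \<inter> V) \<noteq> {}"
          using near[OF openin_open_Int[OF \<open>open V\<close>] _ y] by blast
        then show "W \<inter> D \<inter> A \<noteq> {}"
          using \<open>V \<subseteq> A\<close> by blast
      qed
    qed
    then show "?L \<subseteq> closure (W \<inter> D)"
      using path_image_subset_closure_open_arc[OF c(1)] closure_minimal[OF _ closed_closure] by blast
  qed
  have 1: "W \<inter> D1 \<in> components (S2 - (X \<union> ?L)) \<and> ?L \<subseteq> closure (W \<inter> D1)"
    using D by (intro key[of D1 D2]) blast+
  have 2: "W \<inter> D2 \<in> components (S2 - (X \<union> ?L)) \<and> ?L \<subseteq> closure (W \<inter> D2)"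
    using D by (intro key[of D2 D1]) blast+
  have "W \<inter> D1 \<noteq> W \<inter> D2"
    using 1 in_components_nonempty D(3) by blast
  moreover have "W - ?L = (W \<inter> D1) \<union> (W \<inter> D2)"
  proof -
    have "W - ?L = W - ?J"
      using W_sub P(2) J_eq by blast
    then show ?thesis
      using D(4) W_sub by blast
  qed
  ultimately show ?thesis
    using 1 2 by (intro that[of "W \<inter> D1" "W \<inter> D2"]) blast+
qed

section \<open>Faces at the edges and vertices of a spherical graph\<close>

lemma doubleton_eq_right: "{x, y} = {x, z} \<longleftrightarrow> y = z"
  by (auto simp: doubleton_eq_iff)

locale sphere_graph =
  fixes \<Theta> :: "'a sgraph"
    and p :: "'a \<Rightarrow> real ^ 3"
    and g :: "'a set \<Rightarrow> real \<Rightarrow> real ^ 3"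
  assumes finite_verts: "finite (verts \<Theta>)"
    and simplicial: "simplicial_graph \<Theta>"
    and embedding: "sphere_embedding \<Theta> p g"
begin

abbreviation "V \<equiv> verts \<Theta>"
abbreviation "E \<equiv> edges \<Theta>"
abbreviation "F \<equiv> faces \<Theta> p g"
abbreviation "G \<equiv> realization p g \<Theta>"
abbreviation "img e \<equiv> path_image (g e)"
abbreviation "open_edge e \<equiv> open_arc (g e)"

text \<open>
The part of the realization that belongs to a set of vertices and a set of edges.
\<close>

definition body :: "'a set \<Rightarrow> 'a set set \<Rightarrow> (real ^ 3) set" where
  "body W H = p ` W \<union> (\<Union>e\<in>H. img e)"

lemma G_eq_body: "G = body V E"
  by (simp add: realization_def body_def)

lemma edge_subset: "e \<in> E \<Longrightarrow> e \<subseteq> V"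
  using simplicial by (auto simp: simplicial_graph_def)

lemma edge_cases:
  assumes "e \<in> E"
  obtains u w where "e = {u, w}" "u \<noteq> w" "u \<in> V" "w \<in> V"
  using simplicial assms unfolding simplicial_graph_def by (metis card_2_iff insert_subset)

lemma edge_at:
  assumes "e \<in> E" "v \<in> e"
  obtains w where "e = {v, w}" "w \<noteq> v" "w \<in> V"
  using edge_cases[OF assms(1)] assms(2) by (metis empty_iff insert_commute insert_iff)

lemma finite_E: "finite E"
proof -
  have "E \<subseteq> Pow V"
    using edge_subset by blast
  then show ?thesis
    using finite_verts by (metis finite_Pow_iff finite_subset)
qed

lemma inj_p: "inj_on p V"
  and p_S2: "v \<in> V \<Longrightarrow> p v \<in> S2"
  and arc_g: "e \<in> E \<Longrightarrow> arc (g e)"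
  and img_S2: "e \<in> E \<Longrightarrow> img e \<subseteq> S2"
  and ends_g: "e \<in> E \<Longrightarrow> {pathstart (g e), pathfinish (g e)} = p ` e"
  and img_verts: "e \<in> E \<Longrightarrow> img e \<inter> p ` V = p ` e"
  and img_Int: "e \<in> E \<Longrightarrow> e' \<in> E \<Longrightarrow> e \<noteq> e' \<Longrightarrow> img e \<inter> img e' = p ` (e \<inter> e')"
  using embedding unfolding sphere_embedding_def by (blast, blast, blast, blast, blast, blast, metis)

lemma open_edge_eq: "e \<in> E \<Longrightarrow> open_edge e = img e - p ` e"
  using ends_g unfolding open_arc_def by simp

lemma img_eq: "e \<in> E \<Longrightarrow> img e = open_edge e \<union> p ` e"
  using open_edge_eq img_verts by blast

lemma end_in_img: "e \<in> E \<Longrightarrow> v \<in> e \<Longrightarrow> p v \<in> img e"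
  using img_verts by blast

lemma open_edge_Int_img: "e \<in> E \<Longrightarrow> e' \<in> E \<Longrightarrow> e \<noteq> e' \<Longrightarrow> open_edge e \<inter> img e' = {}"
  using img_Int[of e e'] open_edge_eq[of e] by blast

lemma open_edge_Int_verts: "e \<in> E \<Longrightarrow> open_edge e \<inter> p ` V = {}"
  using img_verts[of e] open_edge_eq[of e] by blast

lemma connected_open_edge: "e \<in> E \<Longrightarrow> connected (open_edge e)"
  by (simp add: connected_open_arc arc_g)

lemma open_edge_nonempty: "e \<in> E \<Longrightarrow> open_edge e \<noteq> {}"
  by (simp add: open_arc_nonempty arc_g)

lemma open_edge_disjoint_body:
  assumes "e \<in> E" "W \<subseteq> V" "H \<subseteq> E" "e \<notin> H"
  shows "open_edge e \<inter> body W H = {}"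
  using assms open_edge_Int_img[OF assms(1)] open_edge_Int_verts[OF assms(1)] unfolding body_def by blast

text \<open>
The embedding turns intersections of subgraphs into intersections of point sets.  All incidences
between arcs and curves built from edges are computed with this rule.
\<close>

lemma body_Int:
  assumes "W \<subseteq> V" "W' \<subseteq> V" "H \<subseteq> E" "H' \<subseteq> E" "\<Union>H \<subseteq> W" "\<Union>H' \<subseteq> W'"
  shows "body W H \<inter> body W' H' = body (W \<inter> W') (H \<inter> H')"
proof
  show "body W H \<inter> body W' H' \<subseteq> body (W \<inter> W') (H \<inter> H')"
  proof
    fix x assume x: "x \<in> body W H \<inter> body W' H'"
    have pW: "p ` W \<inter> p ` W' = p ` (W \<inter> W')"
      using inj_on_image_Int[OF inj_p assms(1,2)] by simp
    have vert: "x \<in> p ` W" if "x \<in> body W H" "x \<in> p ` V" "W \<subseteq> V" "H \<subseteq> E" "\<Union>H \<subseteq> W" for W H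
      using that img_verts unfolding body_def by blast
    show "x \<in> body (W \<inter> W') (H \<inter> H')"
    proof (cases "x \<in> p ` V")
      case True
      then have "x \<in> p ` W" "x \<in> p ` W'"
        using x assms True vert[of W H] vert[of W' H'] by blast+
      then show ?thesis
        using pW unfolding body_def by blast
    next
      case False
      then obtain e e' where e: "e \<in> H" "x \<in> img e" "e' \<in> H'" "x \<in> img e'"
        using x assms unfolding body_def by blast
      have "e = e'"
      proof (rule ccontr)
        assume "e \<noteq> e'"
        then have "x \<in> p ` (e \<inter> e')"
          using img_Int[of e e'] e assms by blast
        then show False
          using False e(1) assms by blast
      qed
      then show ?thesis
        using e unfolding body_def by blast
    qed
  qed
qed (auto simp: body_def)

lemma img_eq_body: "e \<in> E \<Longrightarrow> img e = body e {e}"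
  using img_verts unfolding body_def by blast

lemma compact_img: "e \<in> E \<Longrightarrow> compact (img e)"
  by (simp add: arc_g compact_arc_image)

lemma compact_body: "W \<subseteq> V \<Longrightarrow> H \<subseteq> E \<Longrightarrow> compact (body W H)"
  unfolding body_def
  using finite_subset[OF _ finite_verts] finite_subset[OF _ finite_E] compact_img
  by (intro compact_Un compact_UN finite_imp_compact[OF finite_imageI]) (simp_all add: subset_iff)

lemma body_S2: "W \<subseteq> V \<Longrightarrow> H \<subseteq> E \<Longrightarrow> body W H \<subseteq> S2"
  unfolding body_def using p_S2 img_S2 by blast

lemma edge_arc:
  assumes "{u, w} \<in> E"
  obtains c where "arc c" "path_image c = img {u, w}" "pathstart c = p u" "pathfinish c = p w"
proof -
  let ?c = "g {u, w}"
  have ends: "{pathstart ?c, pathfinish ?c} = {p u, p w}"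
    using ends_g[OF assms] by simp
  show ?thesis
  proof (cases "pathstart ?c = p u")
    case True
    then have "pathfinish ?c = p w"
      using ends by (simp add: doubleton_eq_right)
    then show ?thesis
      using that[of ?c] True arc_g[OF assms] by simp
  next
    case False
    then have "pathstart ?c = p w" "pathfinish ?c = p u"
      using ends by (auto simp: doubleton_eq_iff)
    then show ?thesis
      using that[of "reversepath ?c"] arc_g[OF assms] by (simp add: arc_reversepath)
  qed
qed

lemma path_component_body:
  assumes "(\<lambda>x y. x \<in> W \<and> y \<in> W \<and> {x, y} \<in> H)\<^sup>*\<^sup>* u w" "u \<in> W" "H \<subseteq> E"
  shows "path_component (body W H) (p u) (p w)"
  using assms(1)
proof (induction rule: rtranclp_induct)
  case base
  then show ?case
    using assms(2) by (simp add: body_def path_component_refl)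
next
  case (step x y)
  then have "{x, y} \<in> E"
    using assms(3) by blast
  then obtain c where c: "arc c" "path_image c = img {x, y}" "pathstart c = p x" "pathfinish c = p y"
    by (rule edge_arc)
  have "path_image c \<subseteq> body W H"
    using c(2) step(2) unfolding body_def by blast
  then have "path_component (body W H) (p x) (p y)"
    using c arc_imp_path unfolding path_component_def by blast
  then show ?case
    using step.IH path_component_trans by metis
qed

lemma path_component_arc:
  fixes X :: "(real ^ 3) set"
  assumes "path_component X a b" "a \<noteq> b"
  obtains c where "arc c" "path_image c \<subseteq> X" "pathstart c = a" "pathfinish c = b"
proof -
  obtain q where q: "path q" "path_image q \<subseteq> X" "pathstart q = a" "pathfinish q = b"
    using assms(1) unfolding path_component_def by (elim exE conjE)
  show ?thesis
  proof (rule path_contains_arc[OF q(1,3,4) assms(2)])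
    fix c
    assume c: "arc c" "path_image c \<subseteq> path_image q" "pathstart c = a" "pathfinish c = b"
    show thesis
      by (rule that[OF c(1) subset_trans[OF c(2) q(2)] c(3,4)])
  qed
qed

lemma face_subset: "f \<in> F \<Longrightarrow> f \<subseteq> S2 - G"
  unfolding faces_def by (rule in_components_subset)

lemma face_S2: "f \<in> F \<Longrightarrow> f \<subseteq> S2"
  using face_subset by blast

lemma face_nonempty: "f \<in> F \<Longrightarrow> f \<noteq> {}"
  unfolding faces_def by (rule in_components_nonempty)

lemma face_connected: "f \<in> F \<Longrightarrow> connected f"
  unfolding faces_def by (rule in_components_connected)

lemma faces_eq: "f \<in> F \<Longrightarrow> f' \<in> F \<Longrightarrow> f \<inter> f' \<noteq> {} \<Longrightarrow> f = f'"
  unfolding faces_def using components_nonoverlap by blast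

lemma compact_G: "compact G"
  by (simp add: G_eq_body compact_body)

lemma face_open: "f \<in> F \<Longrightarrow> openin (top_of_set S2) f"
  unfolding faces_def by (rule openin_component_S2_Diff[OF compact_G])

text \<open>
The definition asks only for some interior point of the edge in the closure of the face, which is easy to
verify; \<open>edge_faces_closure\<close> shows that the closure then contains the whole edge.
\<close>

definition edge_faces :: "'a set \<Rightarrow> (real ^ 3) set set" where
  "edge_faces e = {f \<in> F. closure f \<inter> open_edge e \<noteq> {}}"

definition vertex_faces :: "'a \<Rightarrow> (real ^ 3) set set" where
  "vertex_faces v = {f \<in> F. p v \<in> closure f}"

definition star :: "'a \<Rightarrow> 'a set set" where
  "star v = {e \<in> E. v \<in> e}"

end

locale cubic_sphere_graph = sphere_graph +
  assumes two_connected: "k_connected 2 \<Theta>"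
    and cubic: "valent 3 \<Theta>"
begin

lemma star_eq:
  assumes "v \<in> V"
  obtains e1 e2 e3 where "star v = {e1, e2, e3}" "e1 \<noteq> e2" "e1 \<noteq> e3" "e2 \<noteq> e3"
proof -
  have "card (star v) = 3"
    using cubic assms by (simp add: valent_def star_def)
  then obtain e1 e2 e3 where "star v = {e1, e2, e3} \<and> e1 \<noteq> e2 \<and> e2 \<noteq> e3 \<and> e1 \<noteq> e3"
    unfolding card_3_iff by metis
  then show ?thesis
    by (elim conjE) (rule that)
qed

lemma star_other:
  assumes "v \<in> V"
  obtains e' where "e' \<in> star v" "e' \<noteq> e"
proof (rule star_eq[OF assms])
  fix e1 e2 e3
  assume "star v = {e1, e2, e3}" "e1 \<noteq> e2"
  then show thesis
    using that[of e1] that[of e2] by (cases "e1 = e") simp_all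
qed

abbreviation "around v \<equiv> body (V - {v}) (E - star v)"

text \<open>
The only place where 2-connectedness is used: removing a vertex and its edges leaves the others
joined.
\<close>

lemma path_component_around:
  assumes "v \<in> V" "u \<in> V - {v}" "w \<in> V - {v}"
  shows "path_component (around v) (p u) (p w)"
proof (rule path_component_body)
  have "induces_connected \<Theta> (V - {v})"
    using two_connected assms(1) unfolding k_connected_def
    by (metis card.empty card_insert_disjoint diff_Suc_1 empty_iff empty_subsetI finite.emptyI
        finite.insertI insert_subset le_refl numeral_2_eq_2)
  then have "(\<lambda>x y. x \<in> V - {v} \<and> y \<in> V - {v} \<and> {x, y} \<in> E)\<^sup>*\<^sup>* u w"
    using assms by (simp add: induces_connected_def)
  then show "(\<lambda>x y. x \<in> V - {v} \<and> y \<in> V - {v} \<and> {x, y} \<in> E - star v)\<^sup>*\<^sup>* u w"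
    by (rule mono_rtranclp[rule_format, rotated]) (auto simp: star_def)
qed (use assms in auto)

text \<open>
The edge \<open>e\<close> cuts the region \<open>W\<close> that is formed by deleting it from the graph.  Its ends \<open>u\<close>, \<open>v\<close> are
joined without \<open>e\<close>: leave \<open>u\<close> by another edge and continue to \<open>v\<close> in the graph without \<open>u\<close>.
\<close>

lemma edge_splits:
  assumes e: "e \<in> E"
  obtains W f1 f2 where "W \<in> components (S2 - body V (E - {e}))" "open_edge e \<subseteq> W"
    "W - img e = f1 \<union> f2" "f1 \<noteq> f2" "edge_faces e = {f1, f2}" "img e \<subseteq> closure f1" "img e \<subseteq> closure f2"
proof -
  obtain u v where uv: "e = {u, v}" "u \<noteq> v" "u \<in> V" "v \<in> V"
    using edge_cases[OF e] .
  obtain c where c: "arc c" "path_image c = img e" "pathstart c = p u" "pathfinish c = p v"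
    using edge_arc[of u v] e uv by metis
  have oc: "open_arc c = open_edge e"
    using c e open_edge_eq[OF e] uv by (simp add: open_arc_def)
  let ?X = "body V (E - {e})"
  have X: "compact ?X" "?X \<subseteq> S2"
    by (intro compact_body body_S2; blast)+
  have XG: "?X \<union> img e = G"
    using e unfolding G_eq_body body_def by blast
  have "img e \<inter> ?X = body e {e} \<inter> ?X"
    using img_eq_body[OF e] by simp
  also have "\<dots> = body (e \<inter> V) ({e} \<inter> (E - {e}))"
    using e edge_subset by (intro body_Int) auto
  also have "\<dots> = {p u, p v}"
    using uv by (auto simp: body_def)
  finally have cX: "path_image c \<inter> ?X = {pathstart c, pathfinish c}"
    by (simp add: c)
  obtain e' where e': "e' \<in> star u" "e' \<noteq> e"
    using star_other[OF uv(3)] .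
  then obtain w where w: "e' = {u, w}" "w \<noteq> u" "w \<in> V" and e'E: "e' \<in> E"
    using edge_at[of e' u] by (auto simp: star_def)
  have uw: "path_component ?X (p u) (p w)"
  proof -
    obtain d where d: "arc d" "path_image d = img e'" "pathstart d = p u" "pathfinish d = p w"
      using edge_arc[of u w] e'E w by metis
    moreover have "path_image d \<subseteq> ?X"
      using d(2) e'E e'(2) unfolding body_def by blast
    ultimately show ?thesis
      using arc_imp_path unfolding path_component_def by blast
  qed
  have wv: "path_component ?X (p w) (p v)"
  proof (rule path_component_of_subset)
    show "around u \<subseteq> ?X"
      using uv(1) unfolding body_def star_def by blast
    show "path_component (around u) (p w) (p v)"
      using uv w by (intro path_component_around) auto
  qed
  have "p v \<noteq> p u"
    using uv inj_onD[OF inj_p, of u v] by auto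
  then obtain P where P: "arc P" "path_image P \<subseteq> ?X" "pathstart P = p v" "pathfinish P = p u"
    by (rule path_component_arc[OF path_component_sym[OF path_component_trans[OF uw wv]]])
  have "open_edge e \<subseteq> S2 - ?X"
    using open_edge_disjoint_body[OF e, of V "E - {e}"] img_S2[OF e] open_edge_eq[OF e] by blast
  then obtain W where W: "W \<in> components (S2 - ?X)" "open_edge e \<subseteq> W"
    using exists_component_superset[OF _ _ connected_open_edge[OF e]] open_edge_nonempty[OF e] by blast
  have Wc: "W \<inter> open_arc c \<noteq> {}"
    using W open_edge_nonempty[OF e] oc by blast
  have cS2: "path_image c \<subseteq> S2"
    using c img_S2[OF e] by simp
  have P': "pathstart P = pathfinish c" "pathfinish P = pathstart c"
    using P c by simp_all
  obtain f1 f2 where f: "f1 \<noteq> f2" "f1 \<in> components (S2 - (?X \<union> path_image c))"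
    "f2 \<in> components (S2 - (?X \<union> path_image c))" "W - path_image c = f1 \<union> f2"
    "path_image c \<subseteq> closure f1" "path_image c \<subseteq> closure f2"
    by (rule arc_splits_component[OF X c(1) cS2 cX P(1,2) P' W(1) Wc])
  have fF: "f1 \<in> F" "f2 \<in> F"
    using f(2,3) XG c(2) by (simp_all add: faces_def)
  have W_op: "openin (top_of_set S2) W"
    using openin_component_S2_Diff[OF X(1) W(1)] .
  have "edge_faces e = {f1, f2}"
  proof
    show "edge_faces e \<subseteq> {f1, f2}"
    proof
      fix f assume "f \<in> edge_faces e"
      then have f': "f \<in> F" "closure f \<inter> open_edge e \<noteq> {}"
        by (auto simp: edge_faces_def)
      have "W \<inter> f \<noteq> {}"
        by (rule openin_meets_closure[OF W_op face_S2[OF f'(1)]]) (use f'(2) W(2) in blast)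
      moreover have "f \<inter> path_image c = {}"
        using face_subset[OF f'(1)] unfolding XG[symmetric] c(2) by blast
      ultimately have "f \<inter> (f1 \<union> f2) \<noteq> {}"
        unfolding f(4)[symmetric] by blast
      then show "f \<in> {f1, f2}"
        using faces_eq[OF f'(1)] fF by blast
    qed
    have "open_edge e \<subseteq> img e"
      using open_edge_eq[OF e] by blast
    then have "closure f1 \<inter> open_edge e \<noteq> {}" "closure f2 \<inter> open_edge e \<noteq> {}"
      using f(5,6) open_edge_nonempty[OF e] unfolding c(2) by blast+
    then show "{f1, f2} \<subseteq> edge_faces e"
      using fF by (simp add: edge_faces_def)
  qed
  then show ?thesis
    by (rule that[OF W f(4)[unfolded c(2)] f(1) _ f(5)[unfolded c(2)] f(6)[unfolded c(2)]])
qed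

lemma edge_faces_pair:
  assumes "e \<in> E"
  obtains f1 f2 where "f1 \<noteq> f2" "edge_faces e = {f1, f2}"
  by (rule edge_splits[OF assms]) (rule that)

lemma edge_faces_closure:
  assumes "e \<in> E" "f \<in> edge_faces e"
  shows "img e \<subseteq> closure f"
proof (rule edge_splits[OF assms(1)])
  fix f1 f2
  assume f: "edge_faces e = {f1, f2}" "img e \<subseteq> closure f1" "img e \<subseteq> closure f2"
  then have "f = f1 \<or> f = f2"
    using assms(2) by simp
  then show ?thesis
    using f(2,3) by (elim disjE) simp_all
qed

lemma edge_faces_vertex_faces:
  assumes "e \<in> E" "v \<in> e" "f \<in> edge_faces e"
  shows "f \<in> vertex_faces v"
proof -
  have "p v \<in> closure f"
    using edge_faces_closure[OF assms(1,3)] end_in_img[OF assms(1,2)] by (rule subsetD)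
  then show ?thesis
    using assms(3) by (simp add: vertex_faces_def edge_faces_def)
qed

text \<open>
Near \<open>v\<close>, delete the three edges and cut the resulting region \<open>W\<close> along \<open>e1 \<union> e2\<close>.  Of the two pieces,
one contains the interior of \<open>e3\<close> and is cut again by \<open>e3\<close> into the two faces at \<open>e3\<close>; the other is the
face \<open>c\<close>.  So \<open>c\<close> borders \<open>e1\<close> and \<open>e2\<close> but not \<open>e3\<close>, and with the faces at \<open>e3\<close> it accounts for all faces
at \<open>v\<close>.
\<close>

lemma vertex_faces_from_edge:
  assumes v: "v \<in> V" and star: "star v = {e1, e2, e3}" "e1 \<noteq> e2" "e1 \<noteq> e3" "e2 \<noteq> e3"
  shows "\<exists>c. c \<in> edge_faces e1 \<and> c \<in> edge_faces e2 \<and> c \<notin> edge_faces e3 \<and>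
    vertex_faces v = insert c (edge_faces e3)"
proof -
  have in_star: "e1 \<in> star v" "e2 \<in> star v" "e3 \<in> star v"
    unfolding star(1) by simp_all
  then have E: "e1 \<in> E" "e2 \<in> E" "e3 \<in> E" and ve: "v \<in> e1" "v \<in> e2" "v \<in> e3"
    by (simp_all add: star_def)
  obtain w1 where w1: "e1 = {v, w1}" "w1 \<noteq> v" "w1 \<in> V"
    using edge_at[OF E(1) ve(1)] .
  obtain w2 where w2: "e2 = {v, w2}" "w2 \<noteq> v" "w2 \<in> V"
    using edge_at[OF E(2) ve(2)] .
  have w12: "w1 \<noteq> w2"
    using w1 w2 star(2) by blast
  obtain c1 where c1: "arc c1" "path_image c1 = img e1" "pathstart c1 = p w1" "pathfinish c1 = p v"
    using edge_arc[of w1 v] E(1) w1(1) by (metis insert_commute)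
  obtain c2 where c2: "arc c2" "path_image c2 = img e2" "pathstart c2 = p v" "pathfinish c2 = p w2"
    using edge_arc[of v w2] E(2) w2(1) by metis
  define c where "c = c1 +++ c2"
  have "e1 \<inter> e2 = {v}"
    using w1 w2 w12 by auto
  then have c: "arc c"
    unfolding c_def using c1 c2 img_Int[OF E(1,2) star(2)] by (intro arc_join) auto
  have c_img: "path_image c = img e1 \<union> img e2"
    unfolding c_def using c1 c2 by (simp add: path_image_join)
  have c_ends: "pathstart c = p w1" "pathfinish c = p w2"
    using c1 c2 by (simp_all add: c_def)
  let ?X = "around v"
  have X: "compact ?X" "?X \<subseteq> S2"
    by (intro compact_body body_S2; blast)+
  have edge_X: "img e \<inter> ?X = {p w}" if "e \<in> star v" "e = {v, w}" "w \<noteq> v" "w \<in> V" for e w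
  proof -
    have "e \<in> E"
      using that by (simp add: star_def)
    then have "img e \<inter> ?X = body e {e} \<inter> ?X"
      using img_eq_body by simp
    also have "\<dots> = body (e \<inter> (V - {v})) ({e} \<inter> (E - star v))"
      using \<open>e \<in> E\<close> edge_subset by (intro body_Int) (auto simp: star_def)
    also have "\<dots> = {p w}"
      using that by (auto simp: body_def)
    finally show ?thesis .
  qed
  have cX: "path_image c \<inter> ?X = {pathstart c, pathfinish c}"
    using edge_X[OF in_star(1) w1] edge_X[OF in_star(2) w2] unfolding c_img c_ends by blast
  have pw: "p w2 \<noteq> p w1" and pv: "p v \<noteq> p w1" "p v \<noteq> p w2"
    using w12 w1 w2 v inj_on_eq_iff[OF inj_p] by simp_all
  have "path_component ?X (p w2) (p w1)"
    using v w1 w2 by (intro path_component_around) auto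
  then obtain P where P: "arc P" "path_image P \<subseteq> ?X" "pathstart P = p w2" "pathfinish P = p w1"
    using pw by (rule path_component_arc)
  have v_c: "p v \<in> open_arc c"
    using pv end_in_img[OF E(1) ve(1)] unfolding open_arc_def c_img c_ends by blast
  then have "p v \<in> S2 - ?X"
    using cX p_S2[OF v] unfolding open_arc_def by blast
  then obtain W where W: "W \<in> components (S2 - ?X)" "p v \<in> W"
    by (metis componentsI connected_component_refl_eq mem_Collect_eq)
  have c_S2: "path_image c \<subseteq> S2"
    using c_img img_S2 E by simp
  have P': "pathstart P = pathfinish c" "pathfinish P = pathstart c"
    using P c_ends by simp_all
  have Wc: "W \<inter> open_arc c \<noteq> {}"
    using W(2) v_c by blast
  \<comment> \<open>First cut: along the path from \<open>w1\<close> through \<open>v\<close> to \<open>w2\<close>.\<close>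
  obtain U1 U2 where U: "U1 \<noteq> U2" "U1 \<in> components (S2 - (?X \<union> path_image c))"
    "U2 \<in> components (S2 - (?X \<union> path_image c))" "W - path_image c = U1 \<union> U2"
    "path_image c \<subseteq> closure U1" "path_image c \<subseteq> closure U2"
    by (rule arc_splits_component[OF X c c_S2 cX P(1,2) P' W(1) Wc])
  let ?Y = "body V (E - {e3})"
  have Y: "?X \<union> path_image c = ?Y"
  proof -
    have "E - {e3} = (E - star v) \<union> {e1, e2}"
      using star E by auto
    then show ?thesis
      using v end_in_img[OF E(1) ve(1)] unfolding c_img body_def by auto
  qed
  have YG: "?Y \<union> img e3 = G"
    using E unfolding G_eq_body body_def by blast
  \<comment> \<open>Second cut: along \<open>e3\<close>, inside the piece \<open>W3\<close> that contains its interior.\<close>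
  obtain W3 f1 f2 where W3: "W3 \<in> components (S2 - ?Y)" "open_edge e3 \<subseteq> W3"
    "W3 - img e3 = f1 \<union> f2" "edge_faces e3 = {f1, f2}"
    by (rule edge_splits[OF E(3)]) (rule that)
  have "open_edge e3 \<subseteq> W"
  proof -
    have "connected (insert (p v) (open_edge e3))"
      using path_image_subset_closure_open_arc[OF arc_g[OF E(3)]] end_in_img[OF E(3) ve(3)] closure_subset
      by (intro connected_intermediate_closure[OF connected_open_edge[OF E(3)]]) auto
    moreover have "insert (p v) (open_edge e3) \<subseteq> S2 - ?X"
      using \<open>p v \<in> S2 - ?X\<close> open_edge_disjoint_body[OF E(3), of "V - {v}" "E - star v"] in_star(3)
        img_S2[OF E(3)] open_edge_eq[OF E(3)] by auto
    ultimately show ?thesis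
      using components_maximal[OF W(1)] W(2) by blast
  qed
  moreover have "open_edge e3 \<inter> path_image c = {}"
    using open_edge_Int_img E star unfolding c_img by blast
  ultimately have in3: "open_edge e3 \<subseteq> U1 \<union> U2"
    using U(4) by blast
  have "W3 = U1 \<or> W3 = U2"
    using in3 W3(1,2) U(2,3) open_edge_nonempty[OF E(3)] components_nonoverlap unfolding Y by blast
  then obtain U' where U': "U' \<noteq> W3" "U' \<in> components (S2 - ?Y)" "W - path_image c = U' \<union> W3"
    "path_image c \<subseteq> closure U'"
    using U unfolding Y by blast
  have U'W3: "U' \<inter> W3 = {}"
    using U'(1,2) W3(1) components_nonoverlap by blast
  have "U' \<inter> img e3 = {}"
  proof -
    have "p ` e3 \<subseteq> ?Y"
      using edge_subset[OF E(3)] unfolding body_def by blast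
    then show ?thesis
      using in_components_subset[OF U'(2)] U'W3 W3(2) img_eq[OF E(3)] by blast
  qed
  then have "U' \<subseteq> S2 - G"
    using in_components_subset[OF U'(2)] YG by blast
  then have U'F: "U' \<in> F"
    unfolding faces_def using YG by (intro components_intermediate_subset[OF U'(2)]) blast+
  have U'_S2: "U' \<subseteq> S2"
    using face_subset[OF U'F] by blast
  have "open_edge e1 \<subseteq> path_image c" "open_edge e2 \<subseteq> path_image c"
    using open_edge_eq E unfolding c_img by blast+
  then have "U' \<in> edge_faces e1" "U' \<in> edge_faces e2"
    using U'F U'(4) open_edge_nonempty E unfolding edge_faces_def by blast+
  moreover have "U' \<notin> edge_faces e3"
  proof
    assume "U' \<in> edge_faces e3"
    then have "W3 \<inter> closure U' \<noteq> {}"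
      using W3(2) unfolding edge_faces_def by blast
    moreover have "openin (top_of_set S2) W3"
      using W3(1) by (intro openin_component_S2_Diff[OF compact_body]) auto
    ultimately have "W3 \<inter> U' \<noteq> {}"
      using openin_meets_closure U'_S2 by blast
    then show False
      using U'W3 by blast
  qed
  moreover have "vertex_faces v = insert U' (edge_faces e3)"
  proof
    show "vertex_faces v \<subseteq> insert U' (edge_faces e3)"
    proof
      fix f assume "f \<in> vertex_faces v"
      then have f: "f \<in> F" "p v \<in> closure f"
        by (auto simp: vertex_faces_def)
      have "W \<inter> f \<noteq> {}"
        by (rule openin_meets_closure[OF openin_component_S2_Diff[OF X(1) W(1)] face_S2[OF f(1)]])
          (use W(2) f(2) in blast)
      then have "f \<inter> (U' \<union> (W3 - img e3)) \<noteq> {}"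
        using face_subset[OF f(1)] YG Y U'(3) by blast
      then have "f \<inter> U' \<noteq> {} \<or> f \<inter> f1 \<noteq> {} \<or> f \<inter> f2 \<noteq> {}"
        unfolding W3(3) by blast
      moreover have "f1 \<in> F" "f2 \<in> F"
        using W3(4) by (auto simp: edge_faces_def)
      ultimately show "f \<in> insert U' (edge_faces e3)"
        using faces_eq[OF f(1)] U'F unfolding W3(4) by blast
    qed
    have "p v \<in> closure U'"
      using U'(4) v_c unfolding open_arc_def by blast
    then show "insert U' (edge_faces e3) \<subseteq> vertex_faces v"
      using edge_faces_vertex_faces[OF E(3) ve(3)] U'F by (auto simp: vertex_faces_def)
  qed
  ultimately show ?thesis
    by blast
qed

text \<open>
The three choices of the last edge in \<open>vertex_faces_from_edge\<close> give a face opposite to each edge.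
They are distinct, and since an edge has only two faces, this determines all incidences.
\<close>

lemma vertex_triangle:
  assumes v: "v \<in> V"
  obtains e1 e2 e3 a b c where "star v = {e1, e2, e3}" "e1 \<noteq> e2" "e1 \<noteq> e3" "e2 \<noteq> e3"
    "vertex_faces v = {a, b, c}" "a \<noteq> b" "a \<noteq> c" "b \<noteq> c"
    "edge_faces e1 = {b, c}" "edge_faces e2 = {a, c}" "edge_faces e3 = {a, b}"
proof -
  obtain e1 e2 e3 where s: "star v = {e1, e2, e3}" "e1 \<noteq> e2" "e1 \<noteq> e3" "e2 \<noteq> e3"
    using star_eq[OF v] .
  have "e1 \<in> star v" "e2 \<in> star v" "e3 \<in> star v"
    unfolding s(1) by simp_all
  then have E: "e1 \<in> E" "e2 \<in> E" "e3 \<in> E"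
    by (simp_all add: star_def)
  have s': "star v = {e1, e3, e2}" "star v = {e2, e3, e1}"
    unfolding s(1) by blast+
  obtain c where c: "c \<in> edge_faces e1" "c \<in> edge_faces e2" "c \<notin> edge_faces e3"
    "vertex_faces v = insert c (edge_faces e3)"
    using vertex_faces_from_edge[OF v s] by (elim exE conjE)
  obtain b where b: "b \<in> edge_faces e1" "b \<in> edge_faces e3" "b \<notin> edge_faces e2"
    using vertex_faces_from_edge[OF v s'(1) s(3,2) s(4)[symmetric]] by (elim exE conjE)
  obtain a where a: "a \<in> edge_faces e2" "a \<in> edge_faces e3" "a \<notin> edge_faces e1"
    using vertex_faces_from_edge[OF v s'(2) s(4) s(2,3)[symmetric]] by (elim exE conjE)
  have ne: "a \<noteq> b" "a \<noteq> c" "b \<noteq> c"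
    using a b c by blast+
  have pair: "edge_faces e = {x, y}"
    if e: "e \<in> E" "x \<in> edge_faces e" "y \<in> edge_faces e" "x \<noteq> y" for e x y
  proof (rule edge_faces_pair[OF e(1)])
    fix f1 f2 assume "edge_faces e = {f1, f2}"
    then show ?thesis
      using e(2-4) by auto
  qed
  have ef: "edge_faces e1 = {b, c}" "edge_faces e2 = {a, c}" "edge_faces e3 = {a, b}"
    using pair[OF E(1) b(1) c(1) ne(3)] pair[OF E(2) a(1) c(2) ne(2)] pair[OF E(3) a(2) b(2) ne(1)] .
  have "vertex_faces v = {a, b, c}"
    unfolding c(4) ef by blast
  then show ?thesis
    using ne ef by (rule that[OF s])
qed

end

section \<open>Legal systems of moves\<close>

lemma legal_state_complement:
  assumes "legal_state \<Gamma> S"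
  shows "legal_state \<Gamma> (verts \<Gamma> - S)"
proof -
  have "verts \<Gamma> - (verts \<Gamma> - S) = S"
    using assms by (auto simp: legal_state_def)
  then show ?thesis
    using assms by (simp add: legal_state_def)
qed

lemma strongly_legal_state_complement:
  assumes "strongly_legal_state \<Gamma> S"
  shows "strongly_legal_state \<Gamma> (verts \<Gamma> - S)"
proof -
  have "verts \<Gamma> - (verts \<Gamma> - S) = S"
    using assms by (auto simp: legal_state_def strongly_legal_state_def)
  moreover have "legal_state \<Gamma> (verts \<Gamma> - S)"
    using assms by (simp add: strongly_legal_state_def legal_state_complement)
  ultimately show ?thesis
    using assms by (simp add: strongly_legal_state_def insert_commute)
qed

text \<open>
All legality arguments reduce to this: a connected set with an isolated vertex is a singleton.
\<close>

lemma induces_connected_isolated: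
  assumes "induces_connected \<Gamma> S" "u \<in> S" "\<And>x. x \<in> S \<Longrightarrow> {u, x} \<notin> edges \<Gamma>"
  shows "S = {u}"
proof -
  have "v = u" if "v \<in> S" for v
  proof -
    have "(\<lambda>x y. x \<in> S \<and> y \<in> S \<and> {x, y} \<in> edges \<Gamma>)\<^sup>*\<^sup>* u v"
      using assms(1,2) that by (simp add: induces_connected_def)
    then show ?thesis
      by (cases rule: converse_rtranclpE) (use assms(3) in auto)
  qed
  then show ?thesis
    using assms(2) by blast
qed

lemma orbit_self: "S \<in> orbit (moves_group \<Gamma> m) sym_diff S"
proof -
  have "{} \<in> carrier (moves_group \<Gamma> m)"
    using generate.one[of "state_group \<Gamma>" "m ` verts \<Gamma>"] by (simp add: moves_group_def state_group_def)
  then show ?thesis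
    unfolding orbit_def by fastforce
qed

lemma orbit_move:
  assumes "T \<in> orbit (moves_group \<Gamma> m) sym_diff S" "v \<in> verts \<Gamma>"
  shows "sym_diff (m v) T \<in> orbit (moves_group \<Gamma> m) sym_diff S"
proof -
  obtain h where h: "h \<in> generate (state_group \<Gamma>) (m ` verts \<Gamma>)" "T = sym_diff h S"
    using assms(1) by (auto simp: orbit_def moves_group_def)
  have "m v \<in> generate (state_group \<Gamma>) (m ` verts \<Gamma>)"
    using assms(2) by (auto intro: generate.incl)
  then have "sym_diff (m v) h \<in> carrier (moves_group \<Gamma> m)"
    using generate.eng[of "m v" "state_group \<Gamma>" "m ` verts \<Gamma>" h] h(1)
    by (simp add: moves_group_def state_group_def)
  moreover have "sym_diff (m v) T = sym_diff (sym_diff (m v) h) S"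
    unfolding h(2) by blast
  ultimately show ?thesis
    unfolding orbit_def by blast
qed

text \<open>
Legality is invariant under complements, so consider the orbit closed up under complements.
If a vertex \<open>v\<close> of one of these sets has all its neighbours in that set, the move at \<open>v\<close> takes \<open>v\<close> to the
other side and leaves its neighbours in place; as an isolated vertex of a connected set, \<open>v\<close> is then
all of that side, so \<open>{v}\<close> itself occurs.  For \<open>w\<close> not adjacent to \<open>v\<close> the same reasoning with the
move at \<open>w\<close> gives \<open>m w = {v, w}\<close>.  Two such vertices \<open>w\<close>, \<open>w'\<close> yield the set \<open>{v, w, w'}\<close>, in which
\<open>v\<close> is isolated: a contradiction.
\<close>

lemma legal_system_imp_strongly_legal:
  assumes sys: "legal_system \<Gamma> m"
    and non_nbrs: "\<And>u. u \<in> verts \<Gamma> \<Longrightarrow> \<exists>w w'. w \<in> verts \<Gamma> \<and> w' \<in> verts \<Gamma> \<and>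
      w \<noteq> u \<and> w' \<noteq> u \<and> w \<noteq> w' \<and> {u, w} \<notin> edges \<Gamma> \<and> {u, w'} \<notin> edges \<Gamma>"
  shows "\<exists>S. strongly_legal_state \<Gamma> S"
proof -
  let ?V = "verts \<Gamma>"
  have mv: "move_at \<Gamma> v (m v)" if "v \<in> ?V" for v
    using sys that by (simp add: legal_system_def move_system_def)
  obtain S where S: "S \<subseteq> ?V" "\<And>T. T \<in> orbit (moves_group \<Gamma> m) sym_diff S \<Longrightarrow> legal_state \<Gamma> T"
    using sys unfolding legal_system_def by blast
  define Q where "Q = {T. T \<subseteq> ?V \<and> (T \<in> orbit (moves_group \<Gamma> m) sym_diff S \<or>
    ?V - T \<in> orbit (moves_group \<Gamma> m) sym_diff S)}"
  have SQ: "S \<in> Q"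
    using S(1) orbit_self by (auto simp: Q_def)
  have Q_compl: "?V - T \<in> Q" if "T \<in> Q" for T
    using that by (auto simp: Q_def double_diff)
  have Q_conn: "induces_connected \<Gamma> T" if "T \<in> Q" for T
  proof -
    have "legal_state \<Gamma> T \<or> legal_state \<Gamma> (?V - T)"
      using that S(2) unfolding Q_def by blast
    moreover have "?V - (?V - T) = T"
      using that unfolding Q_def by blast
    ultimately show ?thesis
      unfolding legal_state_def by auto
  qed
  have Q_move: "sym_diff (m v) T \<in> Q" if T: "T \<in> Q" and v: "v \<in> ?V" for v T
  proof -
    have sub: "m v \<subseteq> ?V" "T \<subseteq> ?V"
      using mv[OF v] T by (auto simp: move_at_def Q_def)
    then have "?V - sym_diff (m v) T = sym_diff (m v) (?V - T)"
      by blast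
    then show ?thesis
      using orbit_move[OF _ v] T sub unfolding Q_def by auto
  qed
  have loopless: "{v, v} \<notin> edges \<Gamma>" if "v \<in> ?V" for v
    using mv[OF that] by (auto simp: move_at_def)
  have no_singleton: "{v} \<notin> Q" if v: "v \<in> ?V" for v
  proof
    assume vQ: "{v} \<in> Q"
    obtain w w' where w: "w \<in> ?V" "w' \<in> ?V" "w \<noteq> v" "w' \<noteq> v" "w \<noteq> w'"
      "{v, w} \<notin> edges \<Gamma>" "{v, w'} \<notin> edges \<Gamma>"
      using non_nbrs[OF v] by blast
    have step: "m x = {v, x}" if x: "x \<in> ?V" "x \<noteq> v" "{v, x} \<notin> edges \<Gamma>" for x
    proof -
      let ?R = "sym_diff (m x) {v}"
      have R: "?R \<in> Q"
        by (rule Q_move[OF vQ x(1)])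
      have xm: "x \<in> m x" and nb: "\<And>y. {y, x} \<in> edges \<Gamma> \<Longrightarrow> y \<notin> m x"
        using mv[OF x(1)] by (auto simp: move_at_def)
      have "{x, y} \<notin> edges \<Gamma>" if "y \<in> ?R" for y
        using that nb[of y] x(3) by (auto simp: insert_commute)
      then have "?R = {x}"
        using xm x(2) by (intro induces_connected_isolated[OF Q_conn[OF R]]) auto
      then show ?thesis
        using x(2) by blast
    qed
    \<comment> \<open>Both moves contain \<open>v\<close>, so composing them from \<open>{v}\<close> passes through \<open>{w}\<close> to \<open>{v, w, w'}\<close>.\<close>
    have mw: "m w = {v, w}" "m w' = {v, w'}"
      using step w by auto
    have "sym_diff (m w) {v} = {w}"
      using mw w by auto
    then have "{w} \<in> Q"
      using Q_move[OF vQ w(1)] by simp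
    then have "sym_diff (m w') {w} \<in> Q"
      using w(2) by (rule Q_move)
    moreover have "sym_diff (m w') {w} = {v, w, w'}"
      using mw w by auto
    ultimately have "{v, w, w'} \<in> Q"
      by simp
    then have "{v, w, w'} = {v}"
      using w(6,7) loopless[OF v] by (intro induces_connected_isolated[OF Q_conn]) auto
    then show False
      using w(3) by blast
  qed
  have nbr: "\<exists>x\<in>?V - T. {v, x} \<in> edges \<Gamma>" if T: "T \<in> Q" and v: "v \<in> T" for T v
  proof (rule ccontr)
    assume no: "\<not> ?thesis"
    have vV: "v \<in> ?V"
      using T v by (auto simp: Q_def)
    have vm: "v \<in> m v" and nb: "\<And>y. {y, v} \<in> edges \<Gamma> \<Longrightarrow> y \<notin> m v"
      using mv[OF vV] by (auto simp: move_at_def)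
    let ?R = "?V - sym_diff (m v) T"
    have R: "?R \<in> Q"
      by (intro Q_compl Q_move T vV)
    have "{v, y} \<notin> edges \<Gamma>" if "y \<in> ?R" for y
      using that nb[of y] no by (auto simp: insert_commute)
    then have "?R = {v}"
      using vm v vV by (intro induces_connected_isolated[OF Q_conn[OF R]]) auto
    then show False
      using R no_singleton[OF vV] by simp
  qed
  have "legal_state \<Gamma> S"
    by (rule S(2)[OF orbit_self])
  moreover have "\<exists>u\<in>S. {u, v} \<in> edges \<Gamma>" if "v \<in> ?V - S" for v
    using nbr[OF Q_compl[OF SQ] that] S(1) by (auto simp: insert_commute double_diff)
  ultimately have "strongly_legal_state \<Gamma> S"
    using nbr[OF SQ] by (simp add: strongly_legal_state_def)
  then show ?thesis
    by blast
qed

text \<open>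
The system moves a whole class \<open>A\<close> or \<open>B\<close> at a time.  It generates a group with at most four
elements, and the four states in the orbit of \<open>S\<close> are \<open>S\<close>, its translate by \<open>A\<close>, and their complements.
\<close>

lemma has_legal_system_bipartite:
  assumes V: "verts \<Gamma> = A \<union> B" "A \<inter> B = {}"
    and indep: "\<And>x y. x \<in> A \<Longrightarrow> y \<in> A \<Longrightarrow> {x, y} \<notin> edges \<Gamma>"
      "\<And>x y. x \<in> B \<Longrightarrow> y \<in> B \<Longrightarrow> {x, y} \<notin> edges \<Gamma>"
    and legal: "legal_state \<Gamma> S" "legal_state \<Gamma> (sym_diff A S)"
  shows "has_legal_system \<Gamma>"
proof -
  let ?V = "verts \<Gamma>"
  define m where "m v = (if v \<in> A then A else B)" for v
  let ?H = "{{}, A, B, A \<union> B}"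
  have S: "S \<subseteq> ?V"
    using legal by (simp add: legal_state_def)
  interpret Z: comm_group "state_group \<Gamma>"
    by (rule comm_group_state_group)
  have gen: "generate (state_group \<Gamma>) (m ` ?V) \<subseteq> ?H"
  proof
    fix h assume "h \<in> generate (state_group \<Gamma>) (m ` ?V)"
    then show "h \<in> ?H"
    proof induction
      case one
      then show ?case by (simp add: state_group_def)
    next
      case (incl h)
      then show ?case by (auto simp: m_def)
    next
      case (inv h)
      then have h: "h \<in> {A, B}"
        by (auto simp: m_def)
      have "inv\<^bsub>state_group \<Gamma>\<^esub> h = h"
        by (rule Z.inv_equality) (use h V in \<open>auto simp: state_group_def\<close>)
      then show ?case using h by auto
    next
      case (eng h1 h2)
      then show ?case
        using V(2) by (auto simp: state_group_def)
    qed
  qed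
  have "move_system \<Gamma> m"
    unfolding move_system_def move_at_def m_def using V indep by auto
  moreover have "legal_state \<Gamma> T" if orb: "T \<in> orbit (moves_group \<Gamma> m) sym_diff S" for T
  proof -
    obtain h where h: "h \<in> generate (state_group \<Gamma>) (m ` ?V)" and T: "T = sym_diff h S"
      using orb unfolding orbit_def moves_group_def by auto
    have "h \<in> ?H"
      using gen h by (rule subsetD)
    then consider "h = {}" | "h = A" | "h = B" | "h = A \<union> B"
      by blast
    then show ?thesis
    proof cases
      case 1
      then show ?thesis using T legal(1) by simp
    next
      case 2
      then show ?thesis using T legal(2) by simp
    next
      case 3
      then have "T = ?V - sym_diff A S"
        using T V S by blast
      then show ?thesis
        using legal_state_complement[OF legal(2)] by simp
    next
      case 4
      then have "T = ?V - S"
        using T V S by blast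
      then show ?thesis
        using legal_state_complement[OF legal(1)] by simp
    qed
  qed
  ultimately show ?thesis
    using S unfolding has_legal_system_def legal_system_def by blast
qed

section \<open>The vertex-face graph\<close>

context sphere_graph
begin

abbreviation "VF \<equiv> vertex_face_graph \<Theta> p g"

lemma verts_VF: "verts VF = Inl ` V \<union> Inr ` F"
  by (auto simp: vertex_face_graph_def)

lemma frontier_of_face:
  assumes "f \<in> F" "v \<in> V"
  shows "p v \<in> (top_of_set S2) frontier_of f \<longleftrightarrow> f \<in> vertex_faces v"
proof -
  have "p v \<in> G"
    using assms(2) by (simp add: realization_def)
  then have "p v \<notin> f"
    using face_subset[OF assms(1)] by blast
  moreover have "(top_of_set S2) interior_of f = f"
    by (rule interior_of_openin[OF face_open[OF assms(1)]])
  moreover have "(top_of_set S2) closure_of f = S2 \<inter> closure f"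
    using face_S2[OF assms(1)] by (simp add: closure_of_subtopology Int_absorb1)
  ultimately show ?thesis
    using p_S2[OF assms(2)] assms(1) by (simp add: frontier_of_def vertex_faces_def)
qed

lemma VF_edge: "{Inl v, Inr f} \<in> edges VF \<longleftrightarrow> v \<in> V \<and> f \<in> vertex_faces v"
proof
  assume "{Inl v, Inr f} \<in> edges VF"
  then have "v \<in> V \<and> f \<in> F \<and> p v \<in> (top_of_set S2) frontier_of f"
    by (auto simp: vertex_face_graph_def doubleton_eq_iff)
  then show "v \<in> V \<and> f \<in> vertex_faces v"
    using frontier_of_face by blast
next
  assume vf: "v \<in> V \<and> f \<in> vertex_faces v"
  then have "f \<in> F"
    by (simp add: vertex_faces_def)
  then show "{Inl v, Inr f} \<in> edges VF"
    using frontier_of_face[of f v] vf by (auto simp: vertex_face_graph_def)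
qed

lemma VF_edge': "{Inr f, Inl v} \<in> edges VF \<longleftrightarrow> v \<in> V \<and> f \<in> vertex_faces v"
  using VF_edge[of v f] by (simp add: insert_commute)

lemma VF_bipartite: "{Inl v, Inl w} \<notin> edges VF" "{Inr f, Inr f'} \<notin> edges VF"
  by (auto simp: vertex_face_graph_def doubleton_eq_iff)

lemma vertex_faces_F: "f \<in> vertex_faces v \<Longrightarrow> f \<in> F"
  and edge_faces_F: "f \<in> edge_faces e \<Longrightarrow> f \<in> F"
  by (simp_all add: vertex_faces_def edge_faces_def)

end

context cubic_sphere_graph
begin

lemma G_cases:
  assumes "y \<in> G"
  obtains e where "e \<in> E" "y \<in> img e"
proof (cases "y \<in> p ` V")
  case True
  then obtain v where v: "v \<in> V" "y = p v"
    by blast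
  obtain e where "e \<in> star v"
    by (rule star_other[OF v(1)])
  then show ?thesis
    using v that[of e] end_in_img[of e v] by (simp add: star_def)
next
  case False
  then show ?thesis
    using assms that by (auto simp: realization_def)
qed

lemma in_closure_of_face:
  assumes "y \<in> S2"
  obtains f where "f \<in> F" "y \<in> closure f"
proof (cases "y \<in> G")
  case True
  then obtain e where e: "e \<in> E" "y \<in> img e"
    by (rule G_cases)
  obtain f where "f \<in> edge_faces e"
    by (rule edge_faces_pair[OF e(1)]) auto
  then show ?thesis
    using that[of f] edge_faces_closure[OF e(1)] e(2) by (auto simp: edge_faces_def)
next
  case False
  define f where "f = connected_component_set (S2 - G) y"
  have "f \<in> F" "y \<in> f"
    using assms False unfolding f_def faces_def by (auto intro: componentsI)
  then show ?thesis
    using that[of f] closure_subset by blast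
qed

lemma openin_meets_face:
  assumes "openin (top_of_set S2) U" "U \<noteq> {}"
  obtains f where "f \<in> F" "U \<inter> f \<noteq> {}"
proof -
  obtain y where y: "y \<in> U" "y \<in> S2"
    using assms openin_imp_subset by blast
  obtain f where f: "f \<in> F" "y \<in> closure f"
    using in_closure_of_face[OF y(2)] .
  have "U \<inter> f \<noteq> {}"
    by (rule openin_meets_closure[OF assms(1) face_S2[OF f(1)]]) (use y f in blast)
  then show ?thesis
    using that f(1) by blast
qed

lemma closure_face_Int_face:
  assumes "f \<in> F" "f' \<in> F" "y \<in> closure f" "y \<in> f'"
  shows "f = f'"
proof -
  have "f' \<inter> f \<noteq> {}"
    by (rule openin_meets_closure[OF face_open[OF assms(2)] face_S2[OF assms(1)]]) (use assms in blast)
  then show ?thesis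
    using faces_eq assms(1,2) by blast
qed

text \<open>
The frontier of a face is nonempty, because the sphere is connected, and lies in the graph; hence
every face borders an edge or a vertex, of which there are finitely many with two or three faces each.
\<close>

lemma finite_faces:
  assumes "V \<noteq> {}"
  shows "finite F"
proof (rule finite_subset)
  show "F \<subseteq> (\<Union>e\<in>E. edge_faces e) \<union> (\<Union>v\<in>V. vertex_faces v)"
  proof
    fix f assume f: "f \<in> F"
    have "G \<noteq> {}"
      using assms by (auto simp: realization_def)
    moreover have "G \<subseteq> S2"
      unfolding G_eq_body by (rule body_S2) auto
    ultimately have "f \<noteq> S2"
      using face_subset[OF f] by blast
    have "\<exists>y\<in>G. y \<in> closure f"
    proof (rule ccontr)
      assume no: "\<not> ?thesis"
      have "S2 \<inter> closure f \<subseteq> f"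
      proof
        fix y assume y: "y \<in> S2 \<inter> closure f"
        then have "y \<in> S2 - G"
          using no by blast
        then obtain f' where f': "f' \<in> F" "y \<in> f'"
          unfolding faces_def by (metis Union_components UnionE)
        then show "y \<in> f"
          using closure_face_Int_face[OF f f'(1)] y by blast
      qed
      then have "S2 \<inter> closure f = f"
        using face_S2[OF f] closure_subset by blast
      then have "closedin (top_of_set S2) f"
        using closed_closure by (metis closedin_closed_Int)
      then have "f = {} \<or> f = S2"
        using connected_clopen[of S2] connected_sphere[of "0 :: real ^ 3" 1] face_open[OF f] by auto
      then show False
        using face_nonempty[OF f] \<open>f \<noteq> S2\<close> by blast
    qed
    then obtain y where y: "y \<in> G" "y \<in> closure f"
      by blast
    then obtain e where e: "e \<in> E" "y \<in> img e"
      by (auto elim: G_cases)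
    show "f \<in> (\<Union>e\<in>E. edge_faces e) \<union> (\<Union>v\<in>V. vertex_faces v)"
    proof (cases "y \<in> open_edge e")
      case True
      then show ?thesis
        using e y f unfolding edge_faces_def by blast
    next
      case False
      then obtain v where "v \<in> e" "y = p v"
        using img_eq[OF e(1)] e(2) by blast
      then show ?thesis
        using edge_subset[OF e(1)] y f unfolding vertex_faces_def by blast
    qed
  qed
  have "finite (edge_faces e)" if "e \<in> E" for e
    by (rule edge_faces_pair[OF that]) simp
  moreover have "finite (vertex_faces v)" if "v \<in> V" for v
    by (rule vertex_triangle[OF that]) simp
  ultimately show "finite ((\<Union>e\<in>E. edge_faces e) \<union> (\<Union>v\<in>V. vertex_faces v))"
    using finite_E finite_verts by simp
qed

lemma two_neighbours:
  assumes "v \<in> V"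
  obtains w w' where "{v, w} \<in> E" "{v, w'} \<in> E" "w \<noteq> w'" "w \<noteq> v" "w' \<noteq> v" "w \<in> V" "w' \<in> V"
proof (rule star_eq[OF assms])
  fix e1 e2 e3
  assume s: "star v = {e1, e2, e3}" "e1 \<noteq> e2"
  then have "e1 \<in> star v" "e2 \<in> star v"
    by simp_all
  then have e: "e1 \<in> E" "v \<in> e1" "e2 \<in> E" "v \<in> e2"
    by (simp_all add: star_def)
  obtain w where w: "e1 = {v, w}" "w \<noteq> v" "w \<in> V"
    using edge_at[OF e(1,2)] .
  obtain w' where w': "e2 = {v, w'}" "w' \<noteq> v" "w' \<in> V"
    using edge_at[OF e(3,4)] .
  show ?thesis
    using that[of w w'] w w' e s(2) by auto
qed

text \<open>
The vertex-face graph is bipartite, so it suffices that each of its two classes has at least three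
elements.
\<close>

lemma VF_non_neighbours:
  assumes "V \<noteq> {}" "u \<in> verts VF"
  shows "\<exists>w w'. w \<in> verts VF \<and> w' \<in> verts VF \<and> w \<noteq> u \<and> w' \<noteq> u \<and> w \<noteq> w' \<and>
    {u, w} \<notin> edges VF \<and> {u, w'} \<notin> edges VF"
proof -
  consider v where "v \<in> V" "u = Inl v" | f where "f \<in> F" "u = Inr f"
    using assms(2) by (auto simp: verts_VF)
  then show ?thesis
  proof cases
    case 1
    obtain w w' where w: "{v, w} \<in> E" "{v, w'} \<in> E" "w \<noteq> w'" "w \<noteq> v" "w' \<noteq> v" "w \<in> V" "w' \<in> V"
      by (rule two_neighbours[OF 1(1)])
    then show ?thesis
      using 1(2) by (intro exI[of _ "Inl w"] exI[of _ "Inl w'"]) (simp add: verts_VF VF_bipartite)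
  next
    case 2
    obtain v where "v \<in> V"
      using assms(1) by blast
    then obtain a b c where abc: "vertex_faces v = {a, b, c}" "a \<noteq> b" "a \<noteq> c" "b \<noteq> c"
      by (rule vertex_triangle)
    have "a \<in> F" "b \<in> F" "c \<in> F"
      using vertex_faces_F[of _ v] unfolding abc(1) by simp_all
    then obtain f1 f2 where "f1 \<in> F" "f2 \<in> F" "f1 \<noteq> f" "f2 \<noteq> f" "f1 \<noteq> f2"
      using abc(2-4) by metis
    then show ?thesis
      using 2(2) by (intro exI[of _ "Inr f1"] exI[of _ "Inr f2"]) (simp add: verts_VF VF_bipartite)
  qed
qed

end

section \<open>From a Hamilton cycle to a state and a system\<close>

text \<open>
One side \<open>D\<close> of a Jordan curve that is formed by a spanning set \<open>H\<close> of edges.  The situation is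
symmetric in the two sides, so each result holds for both.
\<close>

locale hamiltonian_side = cubic_sphere_graph +
  fixes H :: "'a set set" and D D' :: "(real ^ 3) set"
  assumes H_sub: "H \<subseteq> E"
    and nonempty: "V \<noteq> {}"
    and D_connected: "connected D"
    and D_open: "openin (top_of_set S2) D"
    and D'_open: "openin (top_of_set S2) D'"
    and disjoint: "D \<inter> D' = {}"
    and sides: "D \<union> D' = S2 - body V H"
    and curve_closure: "body V H \<subseteq> closure D"
begin

definition side_faces :: "(real ^ 3) set set" where
  "side_faces = {f \<in> F. f \<subseteq> D}"

lemma face_in_sides: "f \<in> F \<Longrightarrow> f \<subseteq> D \<union> D'"
  using face_subset[of f] H_sub unfolding sides G_eq_body body_def by blast

lemma meets_side: "f \<in> F \<Longrightarrow> f \<inter> D \<noteq> {} \<Longrightarrow> f \<in> side_faces"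
  using connected_subset_openin_part[OF D_open D'_open disjoint face_connected face_in_sides]
  by (auto simp: side_faces_def)

lemma D_S2: "D \<subseteq> S2"
  using D_open by (rule openin_imp_subset)

lemma D_covered: "D \<subseteq> (\<Union>f\<in>side_faces. closure f)"
proof
  fix y assume y: "y \<in> D"
  then have "y \<in> S2"
    using D_S2 by blast
  then obtain f where f: "f \<in> F" "y \<in> closure f"
    by (rule in_closure_of_face)
  have "D \<inter> f \<noteq> {}"
    by (rule openin_meets_closure[OF D_open face_S2[OF f(1)]]) (use y f in blast)
  then have "f \<in> side_faces"
    using f(1) by (intro meets_side) auto
  then show "y \<in> (\<Union>f\<in>side_faces. closure f)"
    using f(2) by blast
qed

lemma finite_side_faces: "finite side_faces"
  using finite_faces[OF nonempty] by (simp add: side_faces_def)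

lemma closed_face_union: "A \<subseteq> side_faces \<Longrightarrow> closed (\<Union>f\<in>A. closure f)"
  using finite_subset[OF _ finite_side_faces] by (intro closed_UN) auto

lemma vertex_meets_side:
  assumes "v \<in> V"
  obtains f where "f \<in> side_faces" "f \<in> vertex_faces v"
proof -
  have "p v \<in> closure D"
    using curve_closure assms by (auto simp: body_def)
  also have "closure D \<subseteq> (\<Union>f\<in>side_faces. closure f)"
    by (intro closure_minimal D_covered closed_face_union) simp
  finally show ?thesis
    using that by (auto simp: side_faces_def vertex_faces_def)
qed

text \<open>
\<open>D\<close> is connected and covered by the closures of its faces, which are finitely many.  So the closures of
\<open>A\<close> and of the remaining faces meet inside \<open>D\<close>, and a common point lies in no face and not on the curve,
that is, inside a chord.
\<close>

lemma chord_between: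
  assumes "A \<subseteq> side_faces" "A \<noteq> {}" "A \<noteq> side_faces"
  obtains e a b where "e \<in> E - H" "a \<in> A" "b \<in> side_faces - A" "a \<in> edge_faces e" "b \<in> edge_faces e"
proof -
  let ?A = "\<Union>f\<in>A. closure f" and ?B = "\<Union>f\<in>side_faces - A. closure f"
  have meets: "(\<Union>f\<in>X. closure f) \<inter> D \<noteq> {}" if X: "X \<subseteq> side_faces" "X \<noteq> {}" for X
  proof -
    obtain f where f: "f \<in> X"
      using X(2) by blast
    then have "f \<in> F" "f \<subseteq> D"
      using X(1) by (auto simp: side_faces_def)
    then show ?thesis
      using face_nonempty[of f] closure_subset[of f] f by blast
  qed
  have "D \<subseteq> ?A \<union> ?B"
    using D_covered assms(1) by blast
  moreover have "?A \<inter> D \<noteq> {}" "?B \<inter> D \<noteq> {}"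
    using assms by (intro meets; blast)+
  moreover have "closed ?A" "closed ?B"
    using assms(1) by (intro closed_face_union; blast)+
  ultimately have "?A \<inter> ?B \<inter> D \<noteq> {}"
    using D_connected unfolding connected_closed by metis
  then obtain y a b where y: "y \<in> D" and a: "a \<in> A" "y \<in> closure a"
    and b: "b \<in> side_faces - A" "y \<in> closure b"
    by blast
  have F: "a \<in> F" "b \<in> F"
    using a(1) b(1) assms(1) by (auto simp: side_faces_def)
  have "y \<in> G"
  proof (rule ccontr)
    assume "y \<notin> G"
    then have "y \<in> S2 - G"
      using y D_S2 by blast
    then obtain f where f: "f \<in> F" "y \<in> f"
      unfolding faces_def by (metis Union_components UnionE)
    then have "a = f" "b = f"
      using closure_face_Int_face F a(2) b(2) by blast+
    then show False
      using a(1) b(1) by blast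
  qed
  then obtain e where e: "e \<in> E" "y \<in> img e"
    by (rule G_cases)
  have y_body: "y \<notin> body V H"
    using y sides by blast
  then have "e \<notin> H"
    using e(2) unfolding body_def by blast
  have "y \<in> open_edge e"
    using y_body img_eq[OF e(1)] e(2) edge_subset[OF e(1)] unfolding body_def by blast
  then have "a \<in> edge_faces e" "b \<in> edge_faces e"
    using F a(2) b(2) unfolding edge_faces_def by blast+
  with e(1) \<open>e \<notin> H\<close> a(1) b(1) show ?thesis
    by (intro that[of e a b]) auto
qed

text \<open>
Faces on both sides of a chord are joined in the vertex-face graph through the end of the chord in \<open>W\<close>; by
\<open>chord_between\<close> these links reach all faces in \<open>D\<close>.
\<close>

lemma side_connected:
  assumes W: "W \<subseteq> V" and chords: "\<And>e. e \<in> E - H \<Longrightarrow> e \<inter> W \<noteq> {}"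
  shows "induces_connected VF (Inl ` W \<union> Inr ` side_faces)"
proof -
  let ?S = "Inl ` W \<union> Inr ` side_faces"
  let ?R = "\<lambda>x y. x \<in> ?S \<and> y \<in> ?S \<and> {x, y} \<in> edges VF"
  have sym: "symp ?R"
    by (auto simp: symp_def insert_commute)
  have incident: "?R (Inl v) (Inr f)" if "v \<in> W" "f \<in> side_faces" "f \<in> vertex_faces v" for v f
    using that W by (auto simp: VF_edge)
  obtain v0 where "v0 \<in> V"
    using nonempty by blast
  then obtain f0 where f0: "f0 \<in> side_faces"
    by (rule vertex_meets_side)
  define A where "A = {f \<in> side_faces. ?R\<^sup>*\<^sup>* (Inr f0) (Inr f)}"
  have "A = side_faces"
  proof (rule ccontr)
    assume "A \<noteq> side_faces"
    moreover have "A \<subseteq> side_faces" "A \<noteq> {}"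
      using f0 by (auto simp: A_def)
    ultimately obtain e a b where e: "e \<in> E - H" "a \<in> A" "b \<in> side_faces - A"
      "a \<in> edge_faces e" "b \<in> edge_faces e"
      using chord_between by blast
    obtain x where x: "x \<in> e" "x \<in> W"
      using chords[OF e(1)] by blast
    have "a \<in> vertex_faces x" "b \<in> vertex_faces x"
      using edge_faces_vertex_faces[of e x] e x by auto
    then have ax: "?R (Inl x) (Inr a)" and bx: "?R (Inl x) (Inr b)"
      using incident[of x] x(2) e(2,3) by (auto simp: A_def)
    have "?R (Inr a) (Inl x)"
      using sympD[OF sym ax] .
    moreover have "?R\<^sup>*\<^sup>* (Inr f0) (Inr a)"
      using e(2) by (simp add: A_def)
    ultimately have "?R\<^sup>*\<^sup>* (Inr f0) (Inl x)"
      by (rule rtranclp.rtrancl_into_rtrancl[rotated])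
    then have "?R\<^sup>*\<^sup>* (Inr f0) (Inr b)"
      using bx by (rule rtranclp.rtrancl_into_rtrancl)
    then show False
      using e(3) by (auto simp: A_def)
  qed
  then have reach_f: "?R\<^sup>*\<^sup>* (Inr f0) (Inr f)" if "f \<in> side_faces" for f
    using that unfolding A_def by blast
  have reach: "?R\<^sup>*\<^sup>* (Inr f0) z" if z: "z \<in> ?S" for z
  proof (cases z)
    case (Inl v)
    then have v: "v \<in> W"
      using z by blast
    then obtain f where f: "f \<in> side_faces" "f \<in> vertex_faces v"
      using vertex_meets_side W by blast
    have "?R (Inr f) (Inl v)"
      using sympD[OF sym incident[OF v f]] .
    then show ?thesis
      unfolding Inl by (rule rtranclp.rtrancl_into_rtrancl[OF reach_f[OF f(1)]])
  next
    case (Inr f)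
    then have "f \<in> side_faces"
      using z by blast
    then show ?thesis
      unfolding Inr by (rule reach_f)
  qed
  have "?R\<^sup>*\<^sup>* u v" if "u \<in> ?S" "v \<in> ?S" for u v
    using equivp_symp[OF equivp_rtranclp[OF sym] reach[OF that(1)]] reach[OF that(2)]
    by (rule rtranclp_trans)
  then show ?thesis
    unfolding induces_connected_def by blast
qed

text \<open>
A face that borders a chord meets \<open>W\<close> in an end of the chord.  Without a chord on its boundary it is
the only face on its side, and then it contains every vertex in its boundary.
\<close>

lemma side_face_meets:
  assumes W: "W \<subseteq> V" "W \<noteq> {}" and chords: "\<And>e. e \<in> E - H \<Longrightarrow> e \<inter> W \<noteq> {}"
    and f: "f \<in> side_faces"
  obtains v where "v \<in> W" "f \<in> vertex_faces v"
proof (cases "side_faces = {f}")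
  case True
  obtain v where v: "v \<in> W"
    using W(2) by blast
  then obtain f' where "f' \<in> side_faces" "f' \<in> vertex_faces v"
    using W(1) vertex_meets_side by blast
  then show ?thesis
    using that[of v] v True by simp
next
  case False
  then obtain e a b where e: "e \<in> E - H" "a \<in> {f}" "a \<in> edge_faces e"
    using chord_between[of "{f}"] f by blast
  obtain v where v: "v \<in> e" "v \<in> W"
    using chords[OF e(1)] by blast
  have "f \<in> vertex_faces v"
    using edge_faces_vertex_faces[of e v f] e v by simp
  then show ?thesis
    using v(2) by (rule that[rotated])
qed

end

context cubic_sphere_graph
begin

text \<open>
If at most one edge \<open>{v, w}\<close> of the circle ended in \<open>v\<close>, then removing the point \<open>w\<close> would separate
\<open>v\<close> from the rest, but a circle minus a point is connected.
\<close>

lemma spanning_circle_two_edges: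
  assumes H: "H \<subseteq> E" and K: "body V H homeomorphic (sphere 0 1 :: (real ^ 2) set)"
    and v: "v \<in> V"
  shows "\<exists>e e'. e \<in> star v \<inter> H \<and> e' \<in> star v \<inter> H \<and> e \<noteq> e'"
proof (rule ccontr)
  assume no: "\<not> ?thesis"
  obtain e where e: "e \<in> star v" and H_v: "star v \<inter> H \<subseteq> {e}"
  proof (cases "star v \<inter> H = {}")
    case True
    then show ?thesis
      using star_other[OF v] that by blast
  next
    case False
    then obtain e where "e \<in> star v \<inter> H"
      by blast
    then show ?thesis
      using no that[of e] by blast
  qed
  have eE: "e \<in> E" and ve: "v \<in> e"
    using e by (simp_all add: star_def)
  obtain w where w: "e = {v, w}" "w \<noteq> v" "w \<in> V"
    by (rule edge_at[OF eE ve])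
  obtain u where u: "u \<in> V" "u \<noteq> v" "u \<noteq> w"
    using two_neighbours[OF v] by metis
  let ?A = "body {v} (star v \<inter> H)" and ?B = "body (V - {v}) (H - star v)"
  let ?S = "body V H - {p w}"
  have closed: "closed ?A" "closed ?B"
    using v H by (intro compact_imp_closed compact_body; blast)+
  have cover: "?S \<subseteq> ?A \<union> ?B"
    unfolding body_def by blast
  have "?A \<subseteq> body e {e}"
    using H_v ve unfolding body_def by blast
  moreover have "body e {e} \<inter> ?B = {p w}"
  proof -
    have "body e {e} \<inter> ?B = body (e \<inter> (V - {v})) ({e} \<inter> (H - star v))"
      using eE H edge_subset by (intro body_Int) (auto simp: star_def)
    also have "\<dots> = {p w}"
      using w e by (auto simp: body_def)
    finally show ?thesis .
  qed
  ultimately have disj: "?A \<inter> ?B \<inter> ?S = {}"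
    by blast
  have "p v \<noteq> p w" "p u \<noteq> p w"
    using inj_on_eq_iff[OF inj_p] u v w by simp_all
  then have "p v \<in> ?A \<inter> ?S" "p u \<in> ?B \<inter> ?S"
    using u v by (auto simp: body_def)
  moreover have "connected ?S"
    using w(3) by (intro circle_delete_connected[OF K]) (auto simp: body_def)
  ultimately show False
    using closed cover disj unfolding connected_closed by (metis empty_iff)
qed

text \<open>
Two of the three edges at a vertex lie on the circle, which leaves at most one chord.
\<close>

lemma spanning_circle_chords_disjoint:
  assumes H: "H \<subseteq> E" and K: "body V H homeomorphic (sphere 0 1 :: (real ^ 2) set)"
    and e: "e \<in> E - H" "e' \<in> E - H" "v \<in> e" "v \<in> e'"
  shows "e = e'"
proof (rule ccontr)
  assume ne: "e \<noteq> e'"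
  have v: "v \<in> V"
    using e edge_subset by blast
  obtain d d' where d: "d \<in> star v \<inter> H" "d' \<in> star v \<inter> H" "d \<noteq> d'"
    using spanning_circle_two_edges[OF H K v] by blast
  have sub: "{d, d', e, e'} \<subseteq> star v"
    using d e by (auto simp: star_def)
  have "d \<notin> {d', e, e'}" "d' \<notin> {e, e'}" "e \<notin> {e'}"
    using d e ne by blast+
  then have "card {d, d', e, e'} = 4"
    by simp
  moreover have "card (star v) = 3"
    using cubic v by (simp add: valent_def star_def)
  moreover have "finite (star v)"
    using finite_E by (simp add: star_def)
  ultimately show False
    using card_mono[OF _ sub] by simp
qed

text \<open>
Choose one end of each edge in \<open>C\<close>; since these edges are disjoint, the other end is never chosen.  If \<open>C\<close> is
empty, a single vertex serves, so that both parts are nonempty in any case.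
\<close>

lemma chord_transversal:
  assumes V: "V \<noteq> {}" and C: "C \<subseteq> E"
    and disj: "\<And>e e' v. e \<in> C \<Longrightarrow> e' \<in> C \<Longrightarrow> v \<in> e \<Longrightarrow> v \<in> e' \<Longrightarrow> e = e'"
  obtains W where "W \<subseteq> V" "W \<noteq> {}" "V - W \<noteq> {}" "\<And>e. e \<in> C \<Longrightarrow> e \<inter> W \<noteq> {} \<and> e \<inter> (V - W) \<noteq> {}"
proof (cases "C = {}")
  case True
  obtain v where v: "v \<in> V"
    using V by blast
  obtain w where "w \<in> V" "w \<noteq> v"
    using two_neighbours[OF v] by metis
  then show ?thesis
    using v True by (intro that[of "{v}"]) auto
next
  case False
  have "\<exists>v. v \<in> e" if "e \<in> C" for e
    using that C edge_cases[of e] by blast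
  then obtain s where s: "\<And>e. e \<in> C \<Longrightarrow> s e \<in> e"
    by metis
  have meet: "e \<inter> s ` C \<noteq> {} \<and> e \<inter> (V - s ` C) \<noteq> {}" if e: "e \<in> C" for e
  proof -
    have eE: "e \<in> E"
      using e C by blast
    obtain w where w: "e = {s e, w}" "w \<noteq> s e" "w \<in> V"
      by (rule edge_at[OF eE s[OF e]])
    have "w \<notin> s ` C"
    proof
      assume "w \<in> s ` C"
      then obtain e' where e': "e' \<in> C" "w = s e'"
        by blast
      have "e = e'"
        by (rule disj[OF e e'(1), of w]) (use w(1) e' s[OF e'(1)] in auto)
      then show False
        using w(2) e'(2) by simp
    qed
    then show ?thesis
      using w s[OF e] e by blast
  qed
  have sub: "s ` C \<subseteq> V"
    using s C edge_subset by blast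
  show ?thesis
    using False meet by (intro that[OF sub _ _ meet]) blast+
qed

lemma Hamilton_cycle_states:
  assumes C: "is_cycle \<Theta> p g C" "V \<subseteq> verts C" and nonempty: "V \<noteq> {}"
  shows "(\<exists>S. strongly_legal_state VF S) \<and> has_legal_system VF"
proof -
  define H where "H = edges C"
  have VC: "verts C = V" and H: "H \<subseteq> E"
    using C by (auto simp: is_cycle_def subgraph_def H_def)
  have body: "realization p g C = body V H"
    by (simp add: realization_def body_def VC H_def)
  have K: "body V H homeomorphic (sphere 0 1 :: (real ^ 2) set)"
    using C(1) by (simp add: is_cycle_def body)
  obtain \<gamma> where \<gamma>: "simple_path \<gamma>" "pathfinish \<gamma> = pathstart \<gamma>" "path_image \<gamma> = body V H"
    by (rule circle_imp_loop[OF K])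
  have "path_image \<gamma> \<subseteq> S2"
    using \<gamma>(3) body_S2[OF _ H] by simp
  then obtain D1 D2 where D: "D1 \<noteq> {}" "D2 \<noteq> {}" "D1 \<inter> D2 = {}" "D1 \<union> D2 = S2 - body V H"
    "connected D1" "connected D2" "openin (top_of_set S2) D1" "openin (top_of_set S2) D2"
    "body V H \<subseteq> closure D1" "body V H \<subseteq> closure D2"
    using Jordan_S2[OF \<gamma>(1,2)] unfolding \<gamma>(3) by metis
  interpret A: hamiltonian_side \<Theta> p g H D1 D2
    using H nonempty D by unfold_locales auto
  interpret B: hamiltonian_side \<Theta> p g H D2 D1
    using H nonempty D by unfold_locales auto
  have F_split: "F = A.side_faces \<union> B.side_faces" and F_disj: "A.side_faces \<inter> B.side_faces = {}"
  proof -
    have "f \<in> A.side_faces \<union> B.side_faces" if f: "f \<in> F" for f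
    proof -
      have "f \<inter> D1 \<noteq> {} \<or> f \<inter> D2 \<noteq> {}"
        using A.face_in_sides[OF f] face_nonempty[OF f] by blast
      then show ?thesis
        using A.meets_side[OF f] B.meets_side[OF f] by blast
    qed
    then show "F = A.side_faces \<union> B.side_faces"
      by (auto simp: A.side_faces_def B.side_faces_def)
    show "A.side_faces \<inter> B.side_faces = {}"
      using face_nonempty D(3) unfolding A.side_faces_def B.side_faces_def by blast
  qed
  obtain W where W: "W \<subseteq> V" "W \<noteq> {}" "V - W \<noteq> {}"
    and chords: "\<And>e. e \<in> E - H \<Longrightarrow> e \<inter> W \<noteq> {} \<and> e \<inter> (V - W) \<noteq> {}"
    by (rule chord_transversal[OF nonempty, of "E - H"])
      (use spanning_circle_chords_disjoint[OF H K] in auto)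
  define S where "S W = Inl ` W \<union> Inr ` A.side_faces" for W :: "'a set"
  have compl: "verts VF - S W = Inl ` (V - W) \<union> Inr ` B.side_faces" for W
    unfolding verts_VF S_def F_split using F_disj by auto
  have legal: "legal_state VF (S W)"
    if W: "W \<subseteq> V" "W \<noteq> {}" "V - W \<noteq> {}" 
      and chords: "\<And>e. e \<in> E - H \<Longrightarrow> e \<inter> W \<noteq> {} \<and> e \<inter> (V - W) \<noteq> {}" for W
  proof -
    have "S W \<subseteq> verts VF"
      unfolding verts_VF S_def F_split using W by auto
    moreover have "induces_connected VF (S W)"
      unfolding S_def using W chords by (intro A.side_connected) auto
    moreover have "induces_connected VF (verts VF - S W)"
      unfolding compl using chords by (intro B.side_connected) auto
    moreover have "S W \<noteq> {}" "verts VF - S W \<noteq> {}"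
      using W unfolding compl by (auto simp: S_def)
    ultimately show ?thesis
      by (simp add: legal_state_def)
  qed
  have "\<exists>y\<in>verts VF - S W. {x, y} \<in> edges VF" if x: "x \<in> S W" for x
  proof (cases x)
    case (Inl v)
    then have v: "v \<in> V"
      using x W by (auto simp: S_def)
    then obtain f where "f \<in> B.side_faces" "f \<in> vertex_faces v"
      by (rule B.vertex_meets_side)
    then show ?thesis
      using v unfolding Inl compl by (intro bexI[of _ "Inr f"]) (auto simp: VF_edge)
  next
    case (Inr f)
    then have "f \<in> A.side_faces"
      using x by (auto simp: S_def)
    moreover have "e \<inter> (V - W) \<noteq> {}" if "e \<in> E - H" for e
      using chords[OF that] by simp
    ultimately obtain v where "v \<in> V - W" "f \<in> vertex_faces v"
      using A.side_face_meets[of "V - W" f] W(3) by blast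
    then show ?thesis
      unfolding Inr compl by (intro bexI[of _ "Inl v"]) (auto simp: VF_edge')
  qed
  moreover have "\<exists>y\<in>S W. {y, x} \<in> edges VF" if x: "x \<in> verts VF - S W" for x
  proof (cases x)
    case (Inl v)
    then have v: "v \<in> V"
      using x unfolding compl by auto
    then obtain f where "f \<in> A.side_faces" "f \<in> vertex_faces v"
      by (rule A.vertex_meets_side)
    then show ?thesis
      using v unfolding Inl S_def by (intro bexI[of _ "Inr f"]) (auto simp: VF_edge')
  next
    case (Inr f)
    then have "f \<in> B.side_faces"
      using x unfolding compl by auto
    moreover have "e \<inter> W \<noteq> {}" if "e \<in> E - H" for e
      using chords[OF that] by simp
    ultimately obtain v where "v \<in> W" "f \<in> vertex_faces v"
      using B.side_face_meets[of W f] W(1,2) by blast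
    then show ?thesis
      using W(1) unfolding Inr S_def by (intro bexI[of _ "Inl v"]) (auto simp: VF_edge)
  qed
  ultimately have "strongly_legal_state VF (S W)"
    using legal[OF W chords] by (simp add: strongly_legal_state_def)
  moreover have "has_legal_system VF"
  proof (rule has_legal_system_bipartite)
    show "verts VF = Inl ` V \<union> Inr ` F"
      by (rule verts_VF)
    show "Inl ` V \<inter> Inr ` F = {}"
      by auto
    show "{x, y} \<notin> edges VF" if "x \<in> Inl ` V" "y \<in> Inl ` V" for x y
      using that VF_bipartite(1) by auto
    show "{x, y} \<notin> edges VF" if "x \<in> Inr ` F" "y \<in> Inr ` F" for x y
      using that VF_bipartite(2) by auto
    show "legal_state VF (S W)"
      by (rule legal[OF W chords])
    have "sym_diff (Inl ` V) (S W) = S (V - W)"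
      using W(1) by (auto simp: S_def)
    moreover have "V - (V - W) = W"
      using W(1) by blast
    then have "legal_state VF (S (V - W))"
      using W chords by (intro legal) auto
    ultimately show "legal_state VF (sym_diff (Inl ` V) (S W))"
      by simp
  qed
  ultimately show ?thesis
    by blast
qed

end

section \<open>From a strongly legal state to a Hamilton cycle\<close>

fun path_edges :: "'a list \<Rightarrow> 'a set set" where
  "path_edges (x # y # zs) = insert {x, y} (path_edges (y # zs))"
| "path_edges _ = {}"

lemma path_edges_subset: "successively (\<lambda>x y. {x, y} \<in> H) xs \<Longrightarrow> path_edges xs \<subseteq> H"
  by (induction xs rule: path_edges.induct) auto

lemma Union_path_edges: "\<Union>(path_edges xs) \<subseteq> set xs"
  by (induction xs rule: path_edges.induct) auto

lemma closing_edge_notin_path_edges: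
  assumes "distinct xs" "length xs \<ge> 3"
  shows "{last xs, hd xs} \<notin> path_edges xs"
proof -
  obtain x y z zs where xs: "xs = x # y # z # zs"
    using assms(2) by (metis One_nat_def Suc_1 Suc_le_length_iff numeral_3_eq_3)
  have "last (z # zs) \<in> set (z # zs)"
    by (rule last_in_set) simp
  then have "last (z # zs) \<noteq> x" "last (z # zs) \<noteq> y"
    using assms(1) unfolding xs by auto
  moreover have "x \<notin> \<Union>(path_edges (y # z # zs))"
    using Union_path_edges[of "y # z # zs"] assms(1) unfolding xs by auto
  ultimately show ?thesis
    unfolding xs by (auto simp: doubleton_eq_iff)
qed

text \<open>
Take a path of maximal length.  All neighbours of its first vertex lie on the path, and there are
two of them, so one closes up a cycle.
\<close>

lemma exists_cycle_list:
  assumes fin: "finite V" and ne: "V \<noteq> {}"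
    and deg: "\<And>v. v \<in> V \<Longrightarrow> \<exists>a\<in>V. \<exists>b\<in>V. a \<noteq> b \<and> a \<noteq> v \<and> b \<noteq> v \<and> {v, a} \<in> H \<and> {v, b} \<in> H"
  obtains xs where "distinct xs" "length xs \<ge> 3" "set xs \<subseteq> V"
    "successively (\<lambda>x y. {x, y} \<in> H) xs" "{last xs, hd xs} \<in> H"
proof -
  \<comment> \<open>Paths as lists of distinct vertices; their length is bounded by the number of vertices.\<close>
  define Q where "Q xs \<longleftrightarrow> distinct xs \<and> set xs \<subseteq> V \<and> successively (\<lambda>x y. {x, y} \<in> H) xs" for xs
  obtain v where v: "v \<in> V"
    using ne by blast
  have "Q [v]"
    using v by (simp add: Q_def)
  moreover have "\<forall>ys. Q ys \<longrightarrow> length ys < Suc (card V)"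
  proof (intro allI impI)
    fix ys assume "Q ys"
    then have "card (set ys) = length ys" "card (set ys) \<le> card V"
      using card_mono[OF fin, of "set ys"] by (auto simp: Q_def distinct_card)
    then show "length ys < Suc (card V)"
      by simp
  qed
  ultimately obtain xs where xs: "Q xs" and max: "\<And>ys. Q ys \<Longrightarrow> length ys \<le> length xs"
    using ex_has_greatest_nat[of Q "[v]" length] by blast
  have "xs \<noteq> []"
    using max[OF \<open>Q [v]\<close>] by auto
  then obtain x ys where x: "xs = x # ys"
    by (cases xs) auto
  have nbr: "a \<in> set ys" if a: "a \<in> V" "a \<noteq> x" "{x, a} \<in> H" for a
  proof (rule ccontr)
    assume "a \<notin> set ys"
    then have "Q (a # xs)"
      using xs a by (auto simp: Q_def x insert_commute)
    then show False
      using max[of "a # xs"] by simp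
  qed
  have "x \<in> V"
    using xs by (simp add: Q_def x)
  then obtain a b where ab: "a \<in> V" "b \<in> V" "a \<noteq> b" "a \<noteq> x" "b \<noteq> x" "{x, a} \<in> H" "{x, b} \<in> H"
    using deg by blast
  then have "a \<in> set ys" "b \<in> set ys"
    using nbr by blast+
  then obtain z zs where z: "ys = z # zs"
    by (cases ys) auto
  obtain y where y: "y \<in> set zs" "{x, y} \<in> H"
    using \<open>a \<in> set ys\<close> \<open>b \<in> set ys\<close> ab by (auto simp: z)
  obtain us ws where us: "zs = us @ y # ws"
    using split_list[OF y(1)] by blast
  let ?c = "x # z # us @ [y]"
  have split: "xs = ?c @ ws"
    by (simp add: x z us)
  have "Q ?c"
    using xs unfolding split Q_def successively_append_iff by auto
  then show ?thesis
    using y(2) by (intro that[of ?c]) (auto simp: Q_def insert_commute)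
qed

context sphere_graph
begin

lemma path_arc:
  assumes "distinct xs" "set xs \<subseteq> V" "successively (\<lambda>x y. {x, y} \<in> E) xs" "length xs \<ge> 2"
  shows "\<exists>c. arc c \<and> pathstart c = p (hd xs) \<and> pathfinish c = p (last xs) \<and>
    path_image c = body (set xs) (path_edges xs)"
  using assms
proof (induction xs rule: path_edges.induct)
  case (1 x y zs)
  let ?e = "{x, y}"
  have e: "?e \<in> E"
    using "1.prems"(3) by simp
  obtain d where d: "arc d" "path_image d = img ?e" "pathstart d = p x" "pathfinish d = p y"
    by (rule edge_arc[OF e])
  show ?case
  proof (cases "zs = []")
    case True
    then show ?thesis
      using d img_eq_body[OF e] by (intro exI[of _ d]) simp
  next
    case False
    let ?ys = "y # zs"
    have "length ?ys \<ge> 2"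
      using False by (cases zs) auto
    then obtain c where c: "arc c" "pathstart c = p y" "pathfinish c = p (last ?ys)"
      "path_image c = body (set ?ys) (path_edges ?ys)"
      using "1.IH" "1.prems" by auto
    have x: "x \<notin> set ?ys"
      using "1.prems"(1) by simp
    have pe: "path_edges ?ys \<subseteq> E"
      using "1.prems"(3) by (intro path_edges_subset) simp
    have "path_image d \<inter> path_image c = body ?e {?e} \<inter> body (set ?ys) (path_edges ?ys)"
      using d(2) c(4) img_eq_body[OF e] by simp
    also have "\<dots> = body (?e \<inter> set ?ys) ({?e} \<inter> path_edges ?ys)"
      using e pe "1.prems"(2) Union_path_edges[of ?ys] by (intro body_Int) auto
    also have "?e \<inter> set ?ys = {y}"
      using x by auto
    also have "{?e} \<inter> path_edges ?ys = {}"
      using Union_path_edges[of ?ys] x by blast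
    finally have int: "path_image d \<inter> path_image c = {p y}"
      by (simp add: body_def)
    have "path_image (d +++ c) = img ?e \<union> body (set ?ys) (path_edges ?ys)"
      using d c by (simp add: path_image_join)
    also have "\<dots> = body (set (x # y # zs)) (path_edges (x # y # zs))"
      unfolding img_eq_body[OF e] by (auto simp: body_def)
    finally have img_eq: "path_image (d +++ c) = body (set (x # y # zs)) (path_edges (x # y # zs))" .
    have "arc (d +++ c)"
      using d c int by (intro arc_join) auto
    then show ?thesis
      using img_eq d(3) c(3) False by (intro exI[of _ "d +++ c"]) simp
  qed
qed auto

lemma cycle_loop:
  assumes xs: "distinct xs" "set xs \<subseteq> V" "successively (\<lambda>x y. {x, y} \<in> E) xs" "length xs \<ge> 3"
    and closing: "{last xs, hd xs} \<in> E"
  obtains \<gamma> where "simple_path \<gamma>" "pathfinish \<gamma> = pathstart \<gamma>"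
    "path_image \<gamma> = body (set xs) (insert {last xs, hd xs} (path_edges xs))"
proof -
  let ?e = "{last xs, hd xs}"
  obtain c where c: "arc c" "pathstart c = p (hd xs)" "pathfinish c = p (last xs)"
    "path_image c = body (set xs) (path_edges xs)"
    using path_arc[OF xs(1-3)] xs(4) by auto
  obtain d where d: "arc d" "path_image d = img ?e" "pathstart d = p (last xs)" "pathfinish d = p (hd xs)"
    by (rule edge_arc[OF closing])
  have "xs \<noteq> []"
    using xs(4) by auto
  then have e_sub: "?e \<subseteq> set xs"
    by simp
  have pe: "path_edges xs \<subseteq> E"
    using xs(3) by (rule path_edges_subset)
  have "path_image c \<inter> path_image d = body (set xs) (path_edges xs) \<inter> body ?e {?e}"
    using d(2) c(4) img_eq_body[OF closing] by simp
  also have "\<dots> = body (set xs \<inter> ?e) (path_edges xs \<inter> {?e})"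
    using closing pe xs(2) e_sub Union_path_edges[of xs] by (intro body_Int) auto
  also have "path_edges xs \<inter> {?e} = {}"
    using closing_edge_notin_path_edges[OF xs(1,4)] by blast
  finally have "path_image c \<inter> path_image d \<subseteq> {pathstart c, pathstart d}"
    using c(2) d(3) by (auto simp: body_def)
  then have 1: "simple_path (c +++ d)"
    using c d by (intro simple_path_join_loop) auto
  have 2: "pathfinish (c +++ d) = pathstart (c +++ d)"
    using c d by simp
  have "path_image (c +++ d) = body (set xs) (path_edges xs) \<union> img ?e"
    using c d by (simp add: path_image_join)
  also have "\<dots> = body (set xs) (insert ?e (path_edges xs))"
    by (auto simp: body_def)
  finally show ?thesis
    by (rule that[OF 1 2])
qed

end

context cubic_sphere_graph
begin

text \<open>
The interior of an edge that is not on the curve lies on one side, and so do both faces that accumulate at it.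
\<close>

lemma faces_across_uncut_edge:
  assumes D: "openin (top_of_set S2) D" "openin (top_of_set S2) D'" "D \<inter> D' = {}"
    and cut: "D \<union> D' = S2 - body W H" "W \<subseteq> V" "H \<subseteq> E"
    and e: "e \<in> E - H" and f: "f \<in> edge_faces e" "f' \<in> edge_faces e" "f \<subseteq> D"
  shows "f' \<subseteq> D"
proof -
  have eE: "e \<in> E"
    using e by simp
  have touch: "U \<inter> h \<noteq> {}" if "openin (top_of_set S2) U" "open_edge e \<subseteq> U" "h \<in> edge_faces e" for U h
  proof (rule openin_meets_closure[OF that(1)])
    show "h \<subseteq> S2"
      using face_S2 edge_faces_F[OF that(3)] by blast
    show "U \<inter> closure h \<noteq> {}"
      using that(2,3) unfolding edge_faces_def by blast
  qed
  have oe: "open_edge e \<subseteq> D \<union> D'"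
    using open_edge_disjoint_body[OF eE cut(2,3)] e open_edge_eq[OF eE] img_S2[OF eE] unfolding cut(1) by blast
  have "open_edge e \<subseteq> D"
  proof (cases "open_edge e \<inter> D = {}")
    case True
    then have "D' \<inter> f \<noteq> {}"
      using oe by (intro touch[OF D(2) _ f(1)]) blast
    then show ?thesis
      using f(3) D(3) by blast
  next
    case False
    then show ?thesis
      by (rule connected_subset_openin_part[OF D connected_open_edge[OF eE] oe])
  qed
  then have "D \<inter> f' \<noteq> {}"
    by (rule touch[OF D(1) _ f(2)])
  moreover have F: "f' \<in> F"
    by (rule edge_faces_F[OF f(2)])
  moreover have "f' \<subseteq> D \<union> D'"
    using face_subset[OF F] cut(2,3) unfolding cut(1) G_eq_body body_def by blast
  ultimately show ?thesis
    by (intro connected_subset_openin_part[OF D face_connected[OF F]]) auto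
qed

text \<open>
Strong legality provides a face of the colour opposite to \<open>v\<close>.  A face of the same colour exists
because the state containing \<open>v\<close> is connected and does not reduce to \<open>v\<close>: otherwise every other
vertex would have to be adjacent to \<open>v\<close> in a bipartite graph.
\<close>

lemma strongly_legal_vertex_faces:
  assumes S: "strongly_legal_state VF S" and v: "v \<in> V"
  shows "\<exists>f\<in>vertex_faces v. Inr f \<in> S" "\<exists>f\<in>vertex_faces v. Inr f \<notin> S"
proof -
  have main: "(\<exists>f\<in>vertex_faces v. Inr f \<in> T) \<and> (\<exists>f\<in>vertex_faces v. Inr f \<notin> T)"
    if T: "strongly_legal_state VF T" and vT: "Inl v \<in> T" for T
  proof
    have conn: "induces_connected VF T"
      using T by (auto simp: strongly_legal_state_def legal_state_def)
    obtain y where y: "y \<in> verts VF - T" "{Inl v, y} \<in> edges VF"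
      using T vT unfolding strongly_legal_state_def by blast
    then obtain f where "y = Inr f"
      using VF_bipartite(1) by (cases y) auto
    then show "\<exists>f\<in>vertex_faces v. Inr f \<notin> T"
      using y by (auto simp: VF_edge)
    obtain w where w: "w \<in> V" "w \<noteq> v"
      using two_neighbours[OF v] by metis
    have "T \<noteq> {Inl v}"
    proof
      assume Tv: "T = {Inl v}"
      then have "Inl w \<in> verts VF - T"
        using w by (auto simp: verts_VF)
      then show False
        using T Tv VF_bipartite(1) unfolding strongly_legal_state_def by blast
    qed
    then obtain x where x: "x \<in> T" "{Inl v, x} \<in> edges VF"
      using induces_connected_isolated[OF conn vT] by blast
    then obtain f where "x = Inr f"
      using VF_bipartite(1) by (cases x) auto
    then show "\<exists>f\<in>vertex_faces v. Inr f \<in> T"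
      using x by (auto simp: VF_edge)
  qed
  have "(\<exists>f\<in>vertex_faces v. Inr f \<in> S) \<and> (\<exists>f\<in>vertex_faces v. Inr f \<notin> S)"
  proof (cases "Inl v \<in> S")
    case True
    then show ?thesis
      by (rule main[OF S])
  next
    case False
    let ?T = "verts VF - S"
    have "Inl v \<in> ?T"
      using False v by (simp add: verts_VF)
    then have "(\<exists>f\<in>vertex_faces v. Inr f \<in> ?T) \<and> (\<exists>f\<in>vertex_faces v. Inr f \<notin> ?T)"
      by (rule main[OF strongly_legal_state_complement[OF S]])
    then show ?thesis
      using vertex_faces_F[of _ v] by (auto simp: verts_VF)
  qed
  then show "\<exists>f\<in>vertex_faces v. Inr f \<in> S" "\<exists>f\<in>vertex_faces v. Inr f \<notin> S"
    by auto
qed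

definition cut_edges :: "('a + (real ^ 3) set) set \<Rightarrow> 'a set set" where
  "cut_edges S = {e \<in> E. \<exists>f\<in>edge_faces e. \<exists>f'\<in>edge_faces e. Inr f \<in> S \<and> Inr f' \<notin> S}"

lemma cut_edges_iff:
  assumes "e \<in> E" "edge_faces e = {f, f'}"
  shows "e \<in> cut_edges S \<longleftrightarrow> (Inr f \<in> S) \<noteq> (Inr f' \<in> S)"
  using assms by (auto simp: cut_edges_def)

text \<open>
The edges at \<open>v\<close> correspond to the pairs among three faces; if these are coloured with both
colours, exactly two pairs are bichromatic.
\<close>

lemma two_cut_edges:
  assumes S: "strongly_legal_state VF S" and v: "v \<in> V"
  shows "\<exists>e e'. e \<in> star v \<inter> cut_edges S \<and> e' \<in> star v \<inter> cut_edges S \<and> e \<noteq> e'"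
proof (rule vertex_triangle[OF v])
  fix e1 e2 e3 a b c
  assume s: "star v = {e1, e2, e3}" "e1 \<noteq> e2" "e1 \<noteq> e3" "e2 \<noteq> e3"
    and vf: "vertex_faces v = {a, b, c}"
    and ef: "edge_faces e1 = {b, c}" "edge_faces e2 = {a, c}" "edge_faces e3 = {a, b}"
  have st: "e1 \<in> star v" "e2 \<in> star v" "e3 \<in> star v"
    unfolding s(1) by simp_all
  then have E: "e1 \<in> E" "e2 \<in> E" "e3 \<in> E"
    by (simp_all add: star_def)
  note cut = cut_edges_iff[OF E(1) ef(1), of S] cut_edges_iff[OF E(2) ef(2), of S]
    cut_edges_iff[OF E(3) ef(3), of S]
  have "Inr a \<in> S \<or> Inr b \<in> S \<or> Inr c \<in> S" "Inr a \<notin> S \<or> Inr b \<notin> S \<or> Inr c \<notin> S"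
    using strongly_legal_vertex_faces[OF S v] unfolding vf by auto
  then have "(e1 \<in> cut_edges S \<and> e2 \<in> cut_edges S) \<or> (e1 \<in> cut_edges S \<and> e3 \<in> cut_edges S) \<or>
      (e2 \<in> cut_edges S \<and> e3 \<in> cut_edges S)"
    unfolding cut by blast
  then show ?thesis
    using st s(2-4) by blast
qed

lemma uncut_edge_between:
  assumes v: "v \<in> V" and f: "f \<in> vertex_faces v" "f' \<in> vertex_faces v" "f \<noteq> f'"
    "Inr f \<in> S \<longleftrightarrow> Inr f' \<in> S"
  obtains e where "e \<in> E - cut_edges S" "f \<in> edge_faces e" "f' \<in> edge_faces e"
proof (rule vertex_triangle[OF v])
  fix e1 e2 e3 a b c
  assume s: "star v = {e1, e2, e3}"
    and vf: "vertex_faces v = {a, b, c}"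
    and ef: "edge_faces e1 = {b, c}" "edge_faces e2 = {a, c}" "edge_faces e3 = {a, b}"
  have "e1 \<in> star v" "e2 \<in> star v" "e3 \<in> star v"
    unfolding s(1) by simp_all
  then have E: "e1 \<in> E" "e2 \<in> E" "e3 \<in> E"
    by (simp_all add: star_def)
  have "{f, f'} = {b, c} \<or> {f, f'} = {a, c} \<or> {f, f'} = {a, b}"
    using f(1-3) unfolding vf by auto
  then obtain e where e: "e \<in> E" "edge_faces e = {f, f'}"
    using E ef by metis
  then have "e \<notin> cut_edges S"
    using cut_edges_iff[OF e, of S] f(4) by simp
  then show ?thesis
    using e by (intro that[of e]) auto
qed

text \<open>
The set \<open>T\<close> will be \<open>S\<close> or its complement.  Follow a path in \<open>T\<close> in the vertex-face graph: two
faces met consecutively share a vertex and a colour, hence also an edge that is not cut, and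
such an edge does not lie on the curve.
\<close>

lemma same_side:
  assumes D: "openin (top_of_set S2) D" "openin (top_of_set S2) D'" "D \<inter> D' = {}"
    and cut: "D \<union> D' = S2 - body W H" "W \<subseteq> V" "H \<subseteq> cut_edges S"
    and conn: "induces_connected VF T" and T: "\<And>f f'. Inr f \<in> T \<Longrightarrow> Inr f' \<in> T \<Longrightarrow> Inr f \<in> S \<longleftrightarrow> Inr f' \<in> S"
    and f: "Inr f \<in> T" "f \<subseteq> D" "Inr f' \<in> T"
  shows "f' \<subseteq> D"
proof -
  \<comment> \<open>Along the path, faces carry the claim, and a vertex records it for all its faces in \<open>T\<close>.\<close>
  define P where "P z = (case z of Inl v \<Rightarrow> \<forall>h\<in>vertex_faces v. Inr h \<in> T \<longrightarrow> h \<subseteq> D | Inr h \<Rightarrow> h \<subseteq> D)" for z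
  have HE: "H \<subseteq> E"
    using cut(3) by (auto simp: cut_edges_def)
  have "(\<lambda>x y. x \<in> T \<and> y \<in> T \<and> {x, y} \<in> edges VF)\<^sup>*\<^sup>* (Inr f) (Inr f')"
    using conn f by (simp add: induces_connected_def)
  then have "P (Inr f')"
  proof (induction rule: rtranclp_induct)
    case base
    then show ?case
      using f(2) by (simp add: P_def)
  next
    case (step x y)
    then have xy: "x \<in> T" "y \<in> T" "{x, y} \<in> edges VF"
      by auto
    show ?case
    proof (cases x)
      case (Inl v)
      then obtain h where h: "y = Inr h"
        using xy(3) VF_bipartite(1) by (cases y) auto
      then show ?thesis
        using step.IH xy unfolding Inl by (simp add: P_def VF_edge)
    next
      case (Inr h)
      then obtain v where v: "y = Inl v"
        using xy(3) VF_bipartite(2) by (cases y) auto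
      have vh: "v \<in> V" "h \<in> vertex_faces v"
        using xy(3) unfolding Inr v by (simp_all add: VF_edge')
      have hD: "h \<subseteq> D"
        using step.IH unfolding Inr by (simp add: P_def)
      have "h' \<subseteq> D" if h': "h' \<in> vertex_faces v" "Inr h' \<in> T" for h'
      proof (cases "h' = h")
        case True
        then show ?thesis using hD by simp
      next
        case False
        have "Inr h \<in> S \<longleftrightarrow> Inr h' \<in> S"
          using T xy(1) h'(2) unfolding Inr by blast
        then obtain e where e: "e \<in> E - cut_edges S" "h \<in> edge_faces e" "h' \<in> edge_faces e"
          using uncut_edge_between[OF vh h'(1)] False by metis
        show ?thesis
          by (rule faces_across_uncut_edge[OF D cut(1,2) HE _ e(2,3) hD]) (use e(1) cut(3) in blast)
      qed
      then show ?thesis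
        unfolding v by (simp add: P_def)
    qed
  qed
  then show ?thesis
    by (simp add: P_def)
qed

lemma strongly_legal_imp_Hamilton_cycle:
  assumes S: "strongly_legal_state VF S" and nonempty: "V \<noteq> {}"
  shows "has_Hamilton_cycle \<Theta> p g"
proof -
  let ?C = "cut_edges S"
  have CE: "?C \<subseteq> E"
    by (auto simp: cut_edges_def)
  have deg: "\<exists>a\<in>V. \<exists>b\<in>V. a \<noteq> b \<and> a \<noteq> v \<and> b \<noteq> v \<and> {v, a} \<in> ?C \<and> {v, b} \<in> ?C" if v: "v \<in> V" for v
  proof -
    obtain e e' where e: "e \<in> star v" "e \<in> ?C" "e' \<in> star v" "e' \<in> ?C" "e \<noteq> e'"
      using two_cut_edges[OF S v] by blast
    then have star: "e \<in> E" "v \<in> e" "e' \<in> E" "v \<in> e'"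
      by (simp_all add: star_def)
    obtain a where a: "e = {v, a}" "a \<noteq> v" "a \<in> V"
      by (rule edge_at[OF star(1,2)])
    obtain b where b: "e' = {v, b}" "b \<noteq> v" "b \<in> V"
      by (rule edge_at[OF star(3,4)])
    show ?thesis
      using a b e by blast
  qed
  obtain xs where xs: "distinct xs" "length xs \<ge> 3" "set xs \<subseteq> V"
    "successively (\<lambda>x y. {x, y} \<in> ?C) xs" "{last xs, hd xs} \<in> ?C"
    by (rule exists_cycle_list[OF finite_verts nonempty deg])
  define H where "H = insert {last xs, hd xs} (path_edges xs)"
  have HC: "H \<subseteq> ?C"
    using path_edges_subset[OF xs(4)] xs(5) by (simp add: H_def)
  have HE: "H \<subseteq> E"
    using HC CE by blast
  have "xs \<noteq> []"
    using xs(2) by auto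
  then have H_xs: "\<Union>H \<subseteq> set xs"
    using Union_path_edges[of xs] by (simp add: H_def)
  have succ: "successively (\<lambda>x y. {x, y} \<in> E) xs"
    by (rule successively_mono[OF xs(4)]) (use CE in blast)
  obtain \<gamma> where \<gamma>: "simple_path \<gamma>" "pathfinish \<gamma> = pathstart \<gamma>" "path_image \<gamma> = body (set xs) H"
    unfolding H_def by (rule cycle_loop[OF xs(1,3) succ xs(2)]) (use xs(5) CE in blast)
  have "V \<subseteq> set xs"
  proof (rule ccontr)
    assume "\<not> ?thesis"
    then obtain u where u: "u \<in> V" "u \<notin> set xs"
      by blast
    \<comment> \<open>A separating edge at the missed vertex \<open>u\<close> is not on the cycle, so both colours occur on one side of it.\<close>
    obtain e where e: "e \<in> star u" "e \<in> ?C"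
      using two_cut_edges[OF S u(1)] by blast
    have eH: "e \<in> E - H"
      using e(1) u(2) H_xs by (auto simp: star_def)
    obtain f f' where f: "f \<in> edge_faces e" "f' \<in> edge_faces e" "Inr f \<in> S" "Inr f' \<notin> S"
      using e(2) unfolding cut_edges_def by blast
    have "path_image \<gamma> \<subseteq> S2"
      using \<gamma>(3) body_S2[OF xs(3) HE] by simp
    then obtain D1 D2 where D12: "D1 \<noteq> {}" "D2 \<noteq> {}" "D1 \<inter> D2 = {}" "D1 \<union> D2 = S2 - body (set xs) H"
      "openin (top_of_set S2) D1" "openin (top_of_set S2) D2"
      using Jordan_S2[OF \<gamma>(1,2)] unfolding \<gamma>(3) by metis
    have in_sides: "h \<subseteq> D1 \<union> D2" if "h \<in> F" for h
      using face_subset[OF that] xs(3) HE unfolding D12(4) G_eq_body body_def by blast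
    have fF: "f \<in> F" "f' \<in> F"
      using f(1,2) edge_faces_F by blast+
    obtain D D' where D: "openin (top_of_set S2) D" "openin (top_of_set S2) D'" "D \<inter> D' = {}"
      "D \<union> D' = S2 - body (set xs) H" "D' \<noteq> {}" "f \<subseteq> D"
    proof (cases "f \<inter> D1 = {}")
      case True
      then have "f \<subseteq> D2"
        using in_sides[OF fF(1)] by blast
      then show ?thesis
        using D12 by (intro that[of D2 D1]) auto
    next
      case False
      then have "f \<subseteq> D1"
        by (rule connected_subset_openin_part[OF D12(5,6,3) face_connected[OF fF(1)] in_sides[OF fF(1)]])
      then show ?thesis
        using D12 by (intro that[of D1 D2]) auto
    qed
    have f'D: "f' \<subseteq> D"
      by (rule faces_across_uncut_edge[OF D(1-4) xs(3) HE eH f(1,2) D(6)])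
    have legal: "induces_connected VF S" "induces_connected VF (verts VF - S)"
      using S by (auto simp: strongly_legal_state_def legal_state_def)
    have all: "h \<subseteq> D" if h: "h \<in> F" for h
    proof (cases "Inr h \<in> S")
      case True
      show ?thesis
        by (rule same_side[OF D(1-4) xs(3) HC legal(1) _ f(3) D(6) True]) simp
    next
      case False
      have "Inr f' \<in> verts VF - S" "Inr h \<in> verts VF - S"
        using False f(4) fF(2) h by (simp_all add: verts_VF)
      then show ?thesis
        by (intro same_side[OF D(1-4) xs(3) HC legal(2) _ _ f'D]) auto
    qed
    obtain h where "h \<in> F" "D' \<inter> h \<noteq> {}"
      by (rule openin_meets_face[OF D(2,5)])
    then show False
      using all D(3) by blast
  qed
  define C where "C = \<lparr>verts = set xs, edges = H\<rparr>"
  have "realization p g C = path_image \<gamma>"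
    unfolding \<gamma>(3) by (simp add: C_def realization_def body_def)
  then have "realization p g C homeomorphic (sphere 0 1 :: (real ^ 2) set)"
    using loop_imp_circle[OF \<gamma>(1,2)] by simp
  moreover have "subgraph C \<Theta>"
    using xs(3) HE H_xs by (auto simp: subgraph_def C_def)
  ultimately have "is_cycle \<Theta> p g C"
    by (simp add: is_cycle_def)
  moreover have "V \<subseteq> verts C"
    using \<open>V \<subseteq> set xs\<close> by (simp add: C_def)
  ultimately show ?thesis
    unfolding has_Hamilton_cycle_def by blast
qed

end

section \<open>The equivalence\<close>

text \<open>
For the empty graph all three conditions fail: the sphere is then the only face, and the
vertex-face graph has a single vertex.
\<close>

theorem theorem6p5:
  fixes \<Theta> :: "'a sgraph"
    and p :: "'a \<Rightarrow> real ^ 3"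
    and g :: "'a set \<Rightarrow> real \<Rightarrow> real ^ 3"
  assumes "finite (verts \<Theta>)"
    and "simplicial_graph \<Theta>"
    and "k_connected 2 \<Theta>"
    and "valent 3 \<Theta>"
    and "sphere_embedding \<Theta> p g"
  shows "(has_Hamilton_cycle \<Theta> p g \<longleftrightarrow> (\<exists>S. strongly_legal_state (vertex_face_graph \<Theta> p g) S)) \<and>
         ((\<exists>S. strongly_legal_state (vertex_face_graph \<Theta> p g) S) \<longleftrightarrow>
            has_legal_system (vertex_face_graph \<Theta> p g))"
proof -
  interpret cubic_sphere_graph \<Theta> p g
    using assms by unfold_locales
  show ?thesis
  proof (cases "V = {}")
    case True
    have "E = {}"
      using edge_cases True by blast
    then have G: "G = {}"
      using True by (simp add: realization_def)
    have no_legal: "\<not> legal_state VF T" for T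
    proof
      assume T: "legal_state VF T"
      have "components S2 = {S2}"
        by (simp add: components_eq_sing_iff connected_sphere sphere_eq_empty)
      then have "F \<subseteq> {S2}"
        unfolding faces_def G by simp
      then have "verts VF \<subseteq> {Inr S2}"
        using True by (auto simp: verts_VF)
      moreover have "T \<subseteq> verts VF" "T \<noteq> {}" "verts VF - T \<noteq> {}"
        using T by (simp_all add: legal_state_def)
      ultimately show False
        by blast
    qed
    have "\<not> has_legal_system VF"
      unfolding has_legal_system_def legal_system_def using no_legal orbit_self by blast
    moreover have "\<not> strongly_legal_state VF T" for T
      using no_legal by (simp add: strongly_legal_state_def)
    moreover have "\<not> has_Hamilton_cycle \<Theta> p g"
    proof
      assume "has_Hamilton_cycle \<Theta> p g"
      then obtain C where C: "subgraph C \<Theta>"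
        "realization p g C homeomorphic (sphere 0 1 :: (real ^ 2) set)"
        by (auto simp: has_Hamilton_cycle_def is_cycle_def)
      have "realization p g C = {}"
        using C(1) True \<open>E = {}\<close> by (simp add: subgraph_def realization_def)
      then have "(sphere 0 1 :: (real ^ 2) set) = {}"
        using C(2) by (auto simp: homeomorphic_def homeomorphism_def)
      then show False
        by (simp add: sphere_eq_empty)
    qed
    ultimately show ?thesis
      by blast
  next
    case False
    have "(\<exists>S. strongly_legal_state VF S) \<and> has_legal_system VF" if "has_Hamilton_cycle \<Theta> p g"
      using that Hamilton_cycle_states[OF _ _ False] unfolding has_Hamilton_cycle_def by blast
    moreover have "\<exists>S. strongly_legal_state VF S" if "has_legal_system VF"
      using that legal_system_imp_strongly_legal[OF _ VF_non_neighbours[OF False]]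
      unfolding has_legal_system_def by blast
    moreover have "has_Hamilton_cycle \<Theta> p g" if "strongly_legal_state VF S" for S
      by (rule strongly_legal_imp_Hamilton_cycle[OF that False])
    ultimately show ?thesis
      by blast
  qed
qed

end
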